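(* Consider the resampled risk model described in the context, in which each $X_i(\cdot)$ is the sum of a (drifted) Brownian motion and a compound Poisson process (with jumps of either sign allowed), under the standing assumptions listed there. Let $\pi(u)=\mathbb{P}(\exists t\ge0:X(t)\ge u)$. Then for any $u\ge0$, $$\pi(u)\le\Omega\,e^{-\omega^\star u},\qquad \Omega:=\max_{i\in\{1,\dots,d\}}\left(\frac{q-\varphi_i(-\omega^\star)}{q}\,\max\{\gamma_i,1\}\right),$$ where $\omega^\star$, $\varphi_i$ and $\gamma_i$ are as defined in the context.
   Context: Model. Let $d\in\mathbb{N}$, $q>0$, and $p_1,\dots,p_d\in[0,1]$ with $\sum_i p_i=1$. For $i=1,\dots,d$ let $X_i(\cdot)$ be a Lévy process with $X_i(0)=0$, the sum of a Brownian motion with drift and an independent compound Poisson process, with Laplace exponent $$\varphi_i(\alpha)=\log\mathbb{E}\,e^{-\alpha X_i(1)}=r_i\alpha+\tfrac12\sigma_i^2\alpha^2-\lambda_i+\lambda_ib_i(\alpha),$$ where $r_i\in\mathbb{R}$, $\sigma_i^2>0$, $\lambda_i>0$ is the claim arrival rate, and $b_i(\alpha)=\mathbb{E}\,e^{-\alpha B_i}$ is the transform of the claim size $B_i$ (a real random variable; negative claims are allowed, so $X_i$ need not be spectrally positive). Let $0=T_0<T_1<T_2<\dots$, where $T_1,T_2,\dots$ are the jump epochs of a Poisson process of rate $q$. Let $J_0,J_1,\dots$ be i.i.d. on $\{1,\dots,d\}$ with $\mathbb{P}(J_n=i)=p_i$; the Lévy processes, the Poisson process and $(J_n)$ are independent.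 Define $X(0)=0$ and recursively $X(t)=X(T_n)+\big(X_{J_n}(t)-X_{J_n}(T_n)\big)$ for $t\in[T_n,T_{n+1})$, where the increment over the interval is also added at its right endpoint to give $X(T_{n+1})$. Let $Y$ be distributed as $X(T_1)$. Standing assumptions. (1) Negative drift: $\sum_{i=1}^d p_i\varphi_i'(0)>0$. (2) Light tails: each $\varphi_i$ is finite in an open neighbourhood of $0$. (3) There is a (unique) $\omega^\star>0$ with $\mathbb{E}\,e^{\omega^\star Y}=1$, i.e. $\sum_{i=1}^d p_i\,\frac{q}{q-\varphi_i(-\omega^\star)}=1$, where $\varphi_i(-\omega^\star)$ is finite and $\varphi_i(-\omega^\star)<q$ for all $i$. Definition of $\gamma_i$. Put $$\lambda_i^{\mathbb Q}=\lambda_ib_i(-\omega^\star),\quad q_i^{\mathbb Q}=q-\varphi_i(-\omega^\star),\quad r_i^{\mathbb Q}=r_i-\omega^\star\sigma_i^2,\quad f_i=\lambda_i+q,\quad f_i^{\mathbb Q}=\lambda_i^{\mathbb Q}+q_i^{\mathbb Q},$$ $$\alpha_{i,\pm}=\frac{\sqrt{r_i^2+2f_i\sigma_i^2}\pm r_i}{\sigma_i^2},\qquad \alpha^{\mathbb Q}_{i,\pm}=\frac{\sqrt{(r^{\mathbb Q}_i)^2+2f^{\mathbb Q}_i\sigma_i^2}\pm r^{\mathbb Q}_i}{\sigma_i^2},$$ $$\gamma_i=\frac{\lambda_i}{\lambda_i^{\mathbb Q}}\,\frac{f_i^{\mathbb Q}}{f_i}\,\frac{\alpha_{i,+}}{\alpha_{i,+}^{\mathbb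 Q}}=\frac{1}{b_i(-\omega^\star)}\cdot\frac{\alpha_{i,-}^{\mathbb Q}}{\alpha_{i,-}}.$$ *)

theory Defs
  imports "HOL-Probability.Probability"
begin

section \<open>Processes on the half-line\<close>

text \<open>
  Processes have index type \<^typ>\<open>real\<close>, but only the restriction to nonnegative times
  carries meaning. Path properties are required at every point of the sample space, which is
  what makes the first-passage event below measurable.
\<close>

definition indep_increments :: "'w measure \<Rightarrow> (real \<Rightarrow> 'w \<Rightarrow> real) \<Rightarrow> bool" where
  "indep_increments M X \<longleftrightarrow>
     (\<forall>t :: nat \<Rightarrow> real. 0 \<le> t 0 \<and> mono t \<longrightarrow>
        prob_space.indep_vars M (\<lambda>_. borel) (\<lambda>k w. X (t (Suc k)) w - X (t k) w) UNIV)"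

definition levy_process :: "'w measure \<Rightarrow> (real \<Rightarrow> 'w \<Rightarrow> real) \<Rightarrow> bool" where
  "levy_process M X \<longleftrightarrow>
     (\<forall>t\<ge>0. X t \<in> borel_measurable M) \<and>
     (\<forall>w\<in>space M. X 0 w = 0) \<and>
     indep_increments M X \<and>
     (\<forall>s\<ge>0. \<forall>h\<ge>0. distr M borel (\<lambda>w. X (s + h) w - X s w) = distr M borel (X h)) \<and>
     (\<forall>w\<in>space M. \<forall>t\<ge>0. ((\<lambda>s. X s w) \<longlongrightarrow> X t w) (at_right t)) \<and>
     (\<forall>w\<in>space M. \<forall>t>0. \<exists>l. ((\<lambda>s. X s w) \<longlongrightarrow> l) (at_left t))"

text \<open>Brownian motion with drift \<open>m\<close> and variance \<open>s\<^sup>2\<close> per unit of time.\<close>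

definition drifted_brownian_motion ::
    "'w measure \<Rightarrow> real \<Rightarrow> real \<Rightarrow> (real \<Rightarrow> 'w \<Rightarrow> real) \<Rightarrow> bool" where
  "drifted_brownian_motion M m s Z \<longleftrightarrow>
     (\<forall>t\<ge>0. Z t \<in> borel_measurable M) \<and>
     (\<forall>w\<in>space M. Z 0 w = 0 \<and> continuous_on {0..} (\<lambda>t. Z t w)) \<and>
     indep_increments M Z \<and>
     (\<forall>a\<ge>0. \<forall>b>a. distributed M lborel (\<lambda>w. Z b w - Z a w)
        (\<lambda>x. ennreal (normal_density (m * (b - a)) (s * sqrt (b - a)) x)))"

text \<open>
  Jump epochs of a Poisson process, given through independent exponential interarrival times;
  epoch \<open>0\<close> is time \<open>0\<close> and is not a jump. Divergence of the epochs says that the counting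
  process is finite at every time.
\<close>

definition poisson_epochs :: "'w measure \<Rightarrow> real \<Rightarrow> (nat \<Rightarrow> 'w \<Rightarrow> real) \<Rightarrow> bool" where
  "poisson_epochs M rate T \<longleftrightarrow>
     (\<forall>n. T n \<in> borel_measurable M) \<and>
     (\<forall>w\<in>space M. T 0 w = 0 \<and> strict_mono (\<lambda>n. T n w) \<and>
        filterlim (\<lambda>n. T n w) at_top sequentially) \<and>
     (\<forall>n. distributed M lborel (\<lambda>w. T (Suc n) w - T n w)
        (\<lambda>x. ennreal (exponential_density rate x))) \<and>
     prob_space.indep_vars M (\<lambda>_. borel) (\<lambda>n w. T (Suc n) w - T n w) UNIV"

definition epoch_count :: "(nat \<Rightarrow> 'w \<Rightarrow> real) \<Rightarrow> real \<Rightarrow> 'w \<Rightarrow> nat" where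
  "epoch_count T t w = card {n. 1 \<le> n \<and> T n w \<le> t}"

definition generated_events ::
    "'w measure \<Rightarrow> 'b measure \<Rightarrow> 'i set \<Rightarrow> ('i \<Rightarrow> 'w \<Rightarrow> 'b) \<Rightarrow> 'w set set" where
  "generated_events M N I X = sigma_sets (space M) {X t -` A \<inter> space M | t A. t \<in> I \<and> A \<in> sets N}"

text \<open>Here \<open>nu\<close> is the law of the claim sizes.\<close>

definition compound_poisson_process ::
    "'w measure \<Rightarrow> real \<Rightarrow> real measure \<Rightarrow> (real \<Rightarrow> 'w \<Rightarrow> real) \<Rightarrow> bool" where
  "compound_poisson_process M lam nu S \<longleftrightarrow>
     (\<exists>(A :: nat \<Rightarrow> 'w \<Rightarrow> real) (B :: nat \<Rightarrow> 'w \<Rightarrow> real).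
        poisson_epochs M lam A \<and>
        (\<forall>k. B k \<in> borel_measurable M \<and> distr M borel (B k) = nu) \<and>
        prob_space.indep_vars M (\<lambda>_. borel) B UNIV \<and>
        prob_space.indep_set M (generated_events M borel UNIV A) (generated_events M borel UNIV B) \<and>
        (\<forall>w\<in>space M. \<forall>t\<ge>0. S t w = (\<Sum>k<epoch_count A t w. B k w)))"

text \<open>
  The Brownian part has drift \<open>-r\<close>, so that \<open>r\<close> enters the Laplace exponent
  \<open>log E exp (-\<alpha> X(1)) = r \<alpha> + s\<^sup>2 \<alpha>\<^sup>2 / 2 - lam + lam E exp (-\<alpha> B)\<close> with a plus sign.
\<close>

definition perturbed_risk_process ::
    "'w measure \<Rightarrow> real \<Rightarrow> real \<Rightarrow> real \<Rightarrow> real measure \<Rightarrow> (real \<Rightarrow> 'w \<Rightarrow> real) \<Rightarrow> bool" where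
  "perturbed_risk_process M r s lam nu X \<longleftrightarrow>
     levy_process M X \<and>
     (\<exists>Z S. drifted_brownian_motion M (- r) s Z \<and>
        compound_poisson_process M lam nu S \<and>
        prob_space.indep_set M (generated_events M borel {0..} Z) (generated_events M borel {0..} S) \<and>
        (\<forall>w\<in>space M. \<forall>t\<ge>0. X t w = Z t w + S t w))"

definition laplace_finite :: "'w measure \<Rightarrow> (real \<Rightarrow> 'w \<Rightarrow> real) \<Rightarrow> real \<Rightarrow> bool" where
  "laplace_finite M X \<alpha> \<longleftrightarrow> integrable M (\<lambda>w. exp (- \<alpha> * X 1 w))"

text \<open>Only meaningful at arguments where \<^const>\<open>laplace_finite\<close> holds.\<close>

definition laplace_exponent :: "'w measure \<Rightarrow> (real \<Rightarrow> 'w \<Rightarrow> real) \<Rightarrow> real \<Rightarrow> real" where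
  "laplace_exponent M X \<alpha> = ln (\<integral>w. exp (- \<alpha> * X 1 w) \<partial>M)"

definition claim_transform :: "real measure \<Rightarrow> real \<Rightarrow> real" where
  "claim_transform nu \<alpha> = (\<integral>x. exp (- \<alpha> * x) \<partial>nu)"

section \<open>The resampled process\<close>

primrec resampled_at_epoch ::
    "(nat \<Rightarrow> real \<Rightarrow> 'w \<Rightarrow> real) \<Rightarrow> (nat \<Rightarrow> 'w \<Rightarrow> real) \<Rightarrow> (nat \<Rightarrow> 'w \<Rightarrow> nat) \<Rightarrow> nat \<Rightarrow> 'w \<Rightarrow> real"
where
  "resampled_at_epoch X T J 0 w = 0"
| "resampled_at_epoch X T J (Suc n) w =
     resampled_at_epoch X T J n w + (X (J n w) (T (Suc n) w) w - X (J n w) (T n w) w)"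

text \<open>\<^term>\<open>epoch_count T t w\<close> is the \<open>n\<close> with \<open>T n w \<le> t < T (Suc n) w\<close>.\<close>

definition resampled ::
    "(nat \<Rightarrow> real \<Rightarrow> 'w \<Rightarrow> real) \<Rightarrow> (nat \<Rightarrow> 'w \<Rightarrow> real) \<Rightarrow> (nat \<Rightarrow> 'w \<Rightarrow> nat) \<Rightarrow> real \<Rightarrow> 'w \<Rightarrow> real"
where
  "resampled X T J t w =
     (let n = epoch_count T t w
      in resampled_at_epoch X T J n w + (X (J n w) t w - X (J n w) (T n w) w))"

datatype source = Levy nat | Clock | Regime

definition source_events ::
    "'w measure \<Rightarrow> (nat \<Rightarrow> real \<Rightarrow> 'w \<Rightarrow> real) \<Rightarrow> (nat \<Rightarrow> 'w \<Rightarrow> real) \<Rightarrow> (nat \<Rightarrow> 'w \<Rightarrow> nat) \<Rightarrow>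
     source \<Rightarrow> 'w set set"
where
  "source_events M X T J c =
     (case c of
        Levy i \<Rightarrow> generated_events M borel {0..} (X i)
      | Clock \<Rightarrow> generated_events M borel UNIV T
      | Regime \<Rightarrow> generated_events M (count_space UNIV) UNIV J)"

definition resampled_risk_model ::
    "'w measure \<Rightarrow> nat \<Rightarrow> real \<Rightarrow> (nat \<Rightarrow> real) \<Rightarrow> (nat \<Rightarrow> real) \<Rightarrow> (nat \<Rightarrow> real) \<Rightarrow> (nat \<Rightarrow> real) \<Rightarrow>
     (nat \<Rightarrow> real measure) \<Rightarrow> (nat \<Rightarrow> real \<Rightarrow> 'w \<Rightarrow> real) \<Rightarrow> (nat \<Rightarrow> 'w \<Rightarrow> real) \<Rightarrow>
     (nat \<Rightarrow> 'w \<Rightarrow> nat) \<Rightarrow> bool"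
where
  "resampled_risk_model M d q p r s lam nu X T J \<longleftrightarrow>
     prob_space M \<and>
     0 < q \<and>
     (\<forall>i\<in>{1..d}. 0 \<le> p i \<and> p i \<le> 1) \<and> (\<Sum>i=1..d. p i) = 1 \<and>
     (\<forall>i\<in>{1..d}. 0 < s i \<and> 0 < lam i \<and>
        perturbed_risk_process M (r i) (s i) (lam i) (nu i) (X i)) \<and>
     poisson_epochs M q T \<and>
     (\<forall>n. J n \<in> measurable M (count_space UNIV)) \<and>
     (\<forall>n. \<forall>w\<in>space M. J n w \<in> {1..d}) \<and>
     (\<forall>n. \<forall>i\<in>{1..d}. measure M {w \<in> space M. J n w = i} = p i) \<and>
     prob_space.indep_vars M (\<lambda>_. count_space UNIV) J UNIV \<and>
     prob_space.indep_sets M (source_events M X T J) (Levy ` {1..d} \<union> {Clock, Regime})"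

definition ruin_probability :: "'w measure \<Rightarrow> (real \<Rightarrow> 'w \<Rightarrow> real) \<Rightarrow> real \<Rightarrow> real" where
  "ruin_probability M Y u = measure M {w \<in> space M. \<exists>t\<ge>0. Y t w \<ge> u}"

section \<open>The constants in the bound\<close>

definition alpha_plus :: "real \<Rightarrow> real \<Rightarrow> real \<Rightarrow> real" where
  "alpha_plus r s f = (sqrt (r\<^sup>2 + 2 * f * s\<^sup>2) + r) / s\<^sup>2"

text \<open>
  The arguments \<open>b\<close> and \<open>phi\<close> stand for the claim transform and the Laplace exponent at
  \<open>-\<omega>\<close>; the suffix \<open>Q\<close> marks parameters under the exponentially tilted measure.
\<close>

definition gamma_coeff :: "real \<Rightarrow> real \<Rightarrow> real \<Rightarrow> real \<Rightarrow> real \<Rightarrow> real \<Rightarrow> real \<Rightarrow> real" where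
  "gamma_coeff q r s lam b phi \<omega> =
     (let lamQ = lam * b; qQ = q - phi; rQ = r - \<omega> * s\<^sup>2;
          f = lam + q; fQ = lamQ + qQ
      in (lam / lamQ) * (fQ / f) * (alpha_plus r s f / alpha_plus rQ s fQ))"

end

theory Submission
  imports Defs
begin

text \<open>
  Write \<open>\<phi>\<^sub>i\<close> for the Laplace exponent of source \<open>i\<close> at \<open>-\<omega>\<close> and
  \<open>h\<^sub>i = q / (q - \<phi>\<^sub>i)\<close>, the \<open>\<omega>\<close>-exponential moment of the increment of source \<open>i\<close> over an
  independent exponential time of rate \<open>q\<close>. The process
  \<open>W(t) = exp (\<omega> X(t)) h\<^sub>J\<^sub>(\<^sub>t\<^sub>)\<close>, with \<open>J(t)\<close> the source active at time \<open>t\<close>, is the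
  conditional expectation of \<open>exp (\<omega> X)\<close> at the next resampling epoch: whatever part of the
  cycle has elapsed, the residual cycle length is again exponential. Hence \<open>W\<close> is a
  nonnegative martingale, and its mean is \<open>\<Sum>i. p\<^sub>i h\<^sub>i = 1\<close> by the choice of \<open>\<omega>\<close>. When
  \<open>X\<close> is at level \<open>u\<close> or above, \<open>W\<close> is at least \<open>exp (\<omega> u) min\<^sub>i h\<^sub>i\<close>, so the maximal
  inequality gives \<open>\<pi>(u) \<le> max\<^sub>i (1 / h\<^sub>i) exp (- \<omega> u)\<close>, with
  \<open>1 / h\<^sub>i = (q - \<phi>\<^sub>i) / q\<close>. Multiplying each term by \<open>max \<gamma>\<^sub>i 1 \<ge> 1\<close> only enlarges the
  maximum.

  The argument is carried out by a discrete first-passage decomposition. Inside each cycle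
  the path is inspected on a grid of mesh \<open>2\<^sup>-\<^sup>N\<close> started at the cycle's epoch. If the
  cycle's first grid crossing of \<open>v\<close> occurs at time \<open>s\<close> into the cycle, then
  \<open>exp (\<omega> X)\<close> at the end of the cycle has conditional mean \<open>exp (\<omega> X) h\<^sub>i\<close>, evaluated at
  the crossing (\<open>exp_increment_to_next_epoch\<close>, used in \<open>first_crossing_bound\<close>).
  Cycles without earlier crossing preserve the mean of \<open>exp (\<omega> X)\<close> (\<open>exp_start_Suc\<close>), so
  the crossing probabilities of successive cycles are paid for out of a total mass \<open>1\<close>
  (\<open>crossing_probability_bound\<close>). Right-continuity transfers the bound from the grids to
  continuous time for every \<open>v < u\<close>, and \<open>v\<close> then tends to \<open>u\<close>.

  The epochs and regimes are random but independent of the Levy paths. Conditioning on them is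
  expressed by giving every functional two arguments from the sample space, one feeding the
  paths and one feeding epochs and regimes; \<open>nn_integral_diagonal\<close> turns an
  expectation on the diagonal into an iterated integral.
\<close>

section \<open>Sigma-algebras generated by families of maps\<close>

lemma sigma_algebra_generated_events: "sigma_algebra (space M) (generated_events M N I Y)"
  unfolding generated_events_def by (intro sigma_algebra_sigma_sets) auto

lemma generated_eventsI:
  "t \<in> I \<Longrightarrow> A \<in> sets N \<Longrightarrow> Y t -` A \<inter> space M \<in> generated_events M N I Y"
  unfolding generated_events_def by auto

lemma generated_events_least:
  assumes "sigma_algebra (space M) \<A>"
    and "\<And>t A. t \<in> I \<Longrightarrow> A \<in> sets N \<Longrightarrow> Y t -` A \<inter> space M \<in> \<A>"
  shows "generated_events M N I Y \<subseteq> \<A>"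
  unfolding generated_events_def
  using assms by (intro sigma_algebra.sigma_sets_subset) auto

lemma generated_events_subset_sets:
  assumes "space G = space M" "\<And>t. t \<in> I \<Longrightarrow> Y t \<in> measurable G N"
  shows "generated_events M N I Y \<subseteq> sets G"
proof (rule generated_events_least)
  show "sigma_algebra (space M) (sets G)"
    using sets.sigma_algebra_axioms[of G] assms(1) by simp
  show "Y t -` A \<inter> space M \<in> sets G" if "t \<in> I" "A \<in> sets N" for t A
    using measurable_sets[OF assms(2)[OF that(1)] that(2)] assms(1) by simp
qed

lemma generated_events_mono:
  "I \<subseteq> I' \<Longrightarrow> generated_events M N I Y \<subseteq> generated_events M N I' Y"
  by (intro generated_events_least sigma_algebra_generated_events generated_eventsI) auto

text \<open>
  The sigma-algebra of \<^const>\<open>generated_events\<close> as a \<^typ>\<open>'a measure\<close>, so that it can serve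
  as the source space in measurability statements.
\<close>

definition generated_algebra where
  "generated_algebra M N I Y = sigma (space M) (generated_events M N I Y)"

lemma space_generated_algebra [simp]: "space (generated_algebra M N I Y) = space M"
  by (simp add: generated_algebra_def space_measure_of_conv)

lemma sets_generated_algebra [simp]:
  "sets (generated_algebra M N I Y) = generated_events M N I Y"
  unfolding generated_algebra_def
  by (rule sigma_algebra.sets_measure_of_eq[OF sigma_algebra_generated_events])

lemma measurable_generated_algebra:
  assumes "t \<in> I" "Y t \<in> space M \<rightarrow> space N"
  shows "Y t \<in> measurable (generated_algebra M N I Y) N"
  using assms by (auto simp: measurable_def intro: generated_eventsI)

lemma subalgebra_generated_algebra:
  assumes "\<And>t. t \<in> I \<Longrightarrow> Y t \<in> measurable M N"
  shows "subalgebra M (generated_algebra M N I Y)"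
  using generated_events_subset_sets[of M M I Y N] assms by (simp add: subalgebra_def)

lemma Int_stable_generated_events: "Int_stable (generated_events M N I Y)"
  unfolding sets_generated_algebra[symmetric] by (rule sets.Int_stable)

lemma generated_events_subset_Pow: "generated_events M N I Y \<subseteq> Pow (space M)"
  using sets.space_closed[of "generated_algebra M N I Y"] by simp

definition join_algebra :: "'a measure \<Rightarrow> 'a measure \<Rightarrow> 'a measure" where
  "join_algebra G H = sigma (space G) (sets G \<union> sets H)"

lemma space_join_algebra [simp]: "space (join_algebra G H) = space G"
  by (simp add: join_algebra_def space_measure_of_conv)

lemma sets_join_algebra:
  "space G = space H \<Longrightarrow> sets (join_algebra G H) = sigma_sets (space G) (sets G \<union> sets H)"
  unfolding join_algebra_def
  using sets.space_closed[of G] sets.space_closed[of H] by (subst sets_measure_of) auto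

lemma subalgebra_join_algebra:
  assumes "subalgebra M G" "subalgebra M H"
  shows "subalgebra M (join_algebra G H)"
  using assms sets.sigma_sets_subset[of "sets G \<union> sets H" M]
  by (auto simp: subalgebra_def sets_join_algebra)

lemma measurable_join_algebra1:
  assumes "space G = space H" "f \<in> measurable G N" shows "f \<in> measurable (join_algebra G H) N"
  using assms by (auto simp: measurable_def sets_join_algebra)

lemma measurable_join_algebra2:
  assumes "space G = space H" "f \<in> measurable H N" shows "f \<in> measurable (join_algebra G H) N"
  using assms by (auto simp: measurable_def sets_join_algebra)

lemma measurable_pair_subalgebra:
  assumes "subalgebra H' H" and F: "F \<in> measurable (G \<Otimes>\<^sub>M H) N"
  shows "F \<in> measurable (G \<Otimes>\<^sub>M H') N"
proof -
  have "(\<lambda>z. (fst z, snd z)) \<in> measurable (G \<Otimes>\<^sub>M H') (G \<Otimes>\<^sub>M H)"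
    by (intro measurable_Pair measurable_fst measurable_compose[OF measurable_snd]
        measurable_from_subalg[OF assms(1) measurable_ident_sets[OF refl]])
  from measurable_compose[OF this F] show ?thesis by simp
qed

section \<open>Independence of sub-sigma-algebras\<close>

context prob_space
begin

lemma indep_set_mono:
  assumes "indep_set A B" "A' \<subseteq> A" "B' \<subseteq> B"
  shows "indep_set A' B'"
  using assms indep_setD_ev1[OF assms(1)] indep_setD_ev2[OF assms(1)]
  by (intro indep_setI) (auto intro: indep_setD[OF assms(1)])

lemma indep_set_sym:
  assumes "indep_set A B" shows "indep_set B A"
proof (rule indep_setI)
  show "prob (b \<inter> a) = prob b * prob a" if "b \<in> B" "a \<in> A" for a b
    using indep_setD[OF assms that(2,1)] by (simp add: Int_commute mult.commute)
qed (use assms in \<open>auto dest: indep_setD_ev1 indep_setD_ev2\<close>)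

text \<open>
  Blocks of an independent family are independent; this separates paths, clock and regimes of
  the model, and one path from all the others.
\<close>

lemma indep_sets_grouped:
  assumes "indep_sets E I" "\<And>i. i \<in> I \<Longrightarrow> Int_stable (E i)"
    and "I1 \<subseteq> I" "I2 \<subseteq> I" "I1 \<inter> I2 = {}"
  shows "indep_set (sigma_sets (space M) (\<Union>i\<in>I1. E i)) (sigma_sets (space M) (\<Union>i\<in>I2. E i))"
proof -
  have "indep_sets (\<lambda>b. sigma_sets (space M) (\<Union>i\<in>case_bool I1 I2 b. E i)) UNIV"
    using assms
    by (intro indep_sets_collect_sigma indep_sets_mono_index[OF _ assms(1)])
       (auto simp: disjoint_family_on_def split: bool.splits)
  then show ?thesis
    unfolding indep_set_def by (rule indep_sets_mono_sets) (auto split: bool.splits)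
qed

text \<open>
  How a past is assembled: if \<open>F\<close> is independent of \<open>P\<close> inside \<open>E\<close>, and \<open>C\<close> is independent of
  all of \<open>E\<close>, then for \<open>c\<close> in \<open>C\<close>, \<open>a\<close> in \<open>P\<close>, \<open>y\<close> in \<open>F\<close> the probability of the intersection
  splits off first \<open>c\<close> and then \<open>a\<close>. The intersections \<open>c \<inter> a\<close> are a generator of the join
  that is stable under intersection.
\<close>

lemma indep_set_join_algebra:
  assumes CE: "indep_set (sets C) (sets E)" and PF: "indep_set (sets P) (sets F)"
    and "subalgebra M C" "subalgebra E P" "subalgebra E F" "subalgebra M E"
  shows "indep_set (sets (join_algebra C P)) (sets F)"
proof -
  have sp: "space C = space M" "space P = space M" "space F = space M" "space E = space M"
    and sub: "sets P \<subseteq> sets E" "sets F \<subseteq> sets E" "sets E \<subseteq> events" "sets C \<subseteq> events"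
    using assms by (auto simp: subalgebra_def)
  let ?D = "{c \<inter> a | c a. c \<in> sets C \<and> a \<in> sets P}"
  have "indep_set ?D (sets F)"
  proof (rule indep_setI)
    fix x y assume "x \<in> ?D" and y: "y \<in> sets F"
    then obtain c a where x: "x = c \<inter> a" "c \<in> sets C" "a \<in> sets P" by auto
    have "prob (c \<inter> (a \<inter> y)) = prob c * prob (a \<inter> y)"
      using x y sub by (intro indep_setD[OF CE]) auto
    also have "\<dots> = prob c * prob a * prob y"
      using indep_setD[OF PF] x y by simp
    also have "prob c * prob a = prob x"
      using x sub by (auto intro!: indep_setD[OF CE, symmetric])
    finally show "prob (x \<inter> y) = prob x * prob y" using x by (simp add: Int_assoc)
  qed (use sub in \<open>auto intro!: sets.Int\<close>)
  moreover have "Int_stable ?D"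
  proof (rule Int_stableI)
    fix x y assume "x \<in> ?D" "y \<in> ?D"
    then obtain c a c' a' where "x = c \<inter> a" "y = c' \<inter> a'" "c \<in> sets C" "a \<in> sets P"
      "c' \<in> sets C" "a' \<in> sets P" by auto
    then have "x \<inter> y = (c \<inter> c') \<inter> (a \<inter> a')" "c \<inter> c' \<in> sets C" "a \<inter> a' \<in> sets P" by auto
    then show "x \<inter> y \<in> ?D" by blast
  qed
  moreover have "Int_stable (sets F)" by (simp add: Int_stable_def)
  ultimately have "indep_set (sigma_sets (space M) ?D) (sigma_sets (space M) (sets F))"
    by (rule indep_set_sigma_sets)
  moreover have "sets C \<union> sets P \<subseteq> ?D"
  proof
    fix x assume "x \<in> sets C \<union> sets P"
    moreover have "x = x \<inter> space M" "x = space M \<inter> x" if "x \<in> sets C \<union> sets P"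
      using that sp sets.sets_into_space[of x C] sets.sets_into_space[of x P] by auto
    moreover have "space M \<in> sets C" "space M \<in> sets P"
      using sets.top[of C] sets.top[of P] sp by auto
    ultimately show "x \<in> ?D" by blast
  qed
  then have "sets (join_algebra C P) \<subseteq> sigma_sets (space M) ?D"
    unfolding sets_join_algebra[OF trans[OF sp(1) sp(2)[symmetric]]] sp(1)
    by (rule sigma_sets_mono')
  ultimately show ?thesis
    by (elim indep_set_mono) auto
qed

lemma indep_set_sequence_past:
  fixes \<xi> :: "nat \<Rightarrow> 'a \<Rightarrow> 'b"
  assumes "indep_vars (\<lambda>_. N) \<xi> UNIV"
  shows "indep_set (generated_events M N {..<n} \<xi>) (generated_events M N {n} \<xi>)"
proof -
  let ?E = "\<lambda>i. {\<xi> i -` A \<inter> space M |A. A \<in> sets N}"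
  have st: "Int_stable (?E i)" for i
  proof (rule Int_stableI)
    fix x y assume "x \<in> ?E i" "y \<in> ?E i"
    then obtain A B where "x = \<xi> i -` A \<inter> space M" "y = \<xi> i -` B \<inter> space M"
      "A \<in> sets N" "B \<in> sets N" by auto
    then have "x \<inter> y = \<xi> i -` (A \<inter> B) \<inter> space M" "A \<inter> B \<in> sets N" by auto
    then show "x \<inter> y \<in> ?E i" by blast
  qed
  have "indep_set (sigma_sets (space M) (\<Union>i\<in>{..<n}. ?E i)) (sigma_sets (space M) (\<Union>i\<in>{n}. ?E i))"
    using assms st by (intro indep_sets_grouped[where I=UNIV]) (auto simp: indep_vars_def2)
  then show ?thesis
    by (rule indep_set_mono; intro generated_events_least sigma_algebra_sigma_sets) auto
qed

text \<open>
  Fubini for independent sub-sigma-algebras: independence says that the diagonal map sends the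
  probability measure to the product of its restrictions to \<open>G\<close> and \<open>H\<close>. With \<open>w2\<close> held fixed,
  the inner integral is the conditional expectation given \<open>H\<close>.
\<close>

lemma nn_integral_diagonal:
  assumes sub: "subalgebra M G" "subalgebra M H" and ind: "indep_set (sets G) (sets H)"
    and f: "f \<in> borel_measurable (G \<Otimes>\<^sub>M H)"
  shows "(\<integral>\<^sup>+w. f (w, w) \<partial>M) = (\<integral>\<^sup>+w2. \<integral>\<^sup>+w1. f (w1, w2) \<partial>M \<partial>M)"
    and "(\<lambda>w2. \<integral>\<^sup>+w1. f (w1, w2) \<partial>M) \<in> borel_measurable H"
    and "w \<in> space M \<Longrightarrow> (\<lambda>w1. f (w1, w)) \<in> borel_measurable G"
proof -
  have sp: "space G = space M" "space H = space M" using sub by (auto simp: subalgebra_def)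
  have id: "(\<lambda>w. w) \<in> measurable M G" "(\<lambda>w. w) \<in> measurable M H"
    using sub by (auto simp: measurable_def subalgebra_def subset_eq intro: sets.Int)
  have sig: "sigma_sets (space M) {A \<inter> space M |A. A \<in> sets K} = sets K"
    if "space K = space M" for K
  proof -
    have "{A \<inter> space M |A. A \<in> sets K} = sets K"
      using sets.Int_space_eq2[of _ K] unfolding that by auto
    then show ?thesis using sets.sigma_sets_eq[of K] that by simp
  qed
  have iv: "indep_var G (\<lambda>w. w) H (\<lambda>w. w)"
    unfolding indep_var_eq using id ind by (simp add: sig sp)
  then have eq: "distr M G (\<lambda>w. w) \<Otimes>\<^sub>M distr M H (\<lambda>w. w) = distr M (G \<Otimes>\<^sub>M H) (\<lambda>w. (w, w))"
    unfolding indep_var_distribution_eq by blast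
  interpret DG: prob_space "distr M G (\<lambda>w. w)" by (rule prob_space_distr) fact
  interpret DH: prob_space "distr M H (\<lambda>w. w)" by (rule prob_space_distr) fact
  interpret P: pair_sigma_finite "distr M G (\<lambda>w. w)" "distr M H (\<lambda>w. w)" ..
  note f[measurable]
  have sec: "(\<lambda>w1. f (w1, w)) \<in> borel_measurable G" if "w \<in> space M" for w
    using measurable_compose[OF measurable_Pair2' f] that sp by simp
  then show "w \<in> space M \<Longrightarrow> (\<lambda>w1. f (w1, w)) \<in> borel_measurable G" .
  have inner: "(\<integral>\<^sup>+w1. f (w1, w) \<partial>distr M G (\<lambda>w. w)) = (\<integral>\<^sup>+w1. f (w1, w) \<partial>M)" if "w \<in> space M" for w
    using sec[OF that] id by (subst nn_integral_distr) auto
  have "(\<lambda>w2. \<integral>\<^sup>+w1. f (w1, w2) \<partial>distr M G (\<lambda>w. w)) \<in> borel_measurable H"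
    by measurable
  then show m: "(\<lambda>w2. \<integral>\<^sup>+w1. f (w1, w2) \<partial>M) \<in> borel_measurable H"
    by (rule measurable_cong[THEN iffD1, rotated]) (simp add: inner sp)
  have "(\<integral>\<^sup>+w. f (w, w) \<partial>M) = (\<integral>\<^sup>+z. f z \<partial>distr M (G \<Otimes>\<^sub>M H) (\<lambda>w. (w, w)))"
    using id f by (subst nn_integral_distr) (auto intro!: measurable_Pair)
  also have "\<dots> = (\<integral>\<^sup>+w2. \<integral>\<^sup>+w1. f (w1, w2) \<partial>distr M G (\<lambda>w. w) \<partial>distr M H (\<lambda>w. w))"
    unfolding eq[symmetric] using f by (subst P.nn_integral_snd) simp_all
  also have "\<dots> = (\<integral>\<^sup>+w2. \<integral>\<^sup>+w1. f (w1, w2) \<partial>distr M G (\<lambda>w. w) \<partial>M)"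
    using id by (subst nn_integral_distr) auto
  also have "\<dots> = (\<integral>\<^sup>+w2. \<integral>\<^sup>+w1. f (w1, w2) \<partial>M \<partial>M)"
    by (intro nn_integral_cong) (simp add: inner)
  finally show "(\<integral>\<^sup>+w. f (w, w) \<partial>M) = (\<integral>\<^sup>+w2. \<integral>\<^sup>+w1. f (w1, w2) \<partial>M \<partial>M)" .
qed

lemma nn_integral_indep_mult:
  assumes sub: "subalgebra M G" "subalgebra M H" and ind: "indep_set (sets G) (sets H)"
    and f[measurable]: "f \<in> borel_measurable G" and g[measurable]: "g \<in> borel_measurable H"
  shows "(\<integral>\<^sup>+w. f w * g w \<partial>M) = (\<integral>\<^sup>+w. f w \<partial>M) * (\<integral>\<^sup>+w. g w \<partial>M)"
proof -
  have [measurable]: "f \<in> borel_measurable M" "g \<in> borel_measurable M"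
    using f g sub by (auto intro: measurable_from_subalg)
  have "(\<integral>\<^sup>+w. f w * g w \<partial>M) = (\<integral>\<^sup>+w2. \<integral>\<^sup>+w1. f w1 * g w2 \<partial>M \<partial>M)"
    using nn_integral_diagonal(1)[OF sub ind, of "\<lambda>(x, y). f x * g y"] by simp
  then show ?thesis by (simp add: nn_integral_multc nn_integral_cmult)
qed

end

section \<open>Levy processes: joint measurability, past and increments, exponential moments\<close>

text \<open>
  The dyadic grid point next to the right of \<open>t\<close> exceeds \<open>t\<close> strictly by at most \<open>2\<^sup>-\<^sup>n\<close>. The
  strict inequality makes right-continuity alone applicable.
\<close>

lemma filterlim_grid_at_right:
  assumes "0 \<le> t"
  shows "filterlim (\<lambda>n. (real (nat \<lfloor>2 ^ n * t\<rfloor>) + 1) / 2 ^ n) (at_right t) sequentially"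
proof -
  let ?\<rho> = "\<lambda>n. (real (nat \<lfloor>2 ^ n * t\<rfloor>) + 1) / 2 ^ n"
  have fl: "real (nat \<lfloor>2 ^ n * t\<rfloor>) = of_int \<lfloor>2 ^ n * t\<rfloor>" for n
    using assms by (simp add: of_nat_nat)
  have lo: "t < ?\<rho> n" for n
    unfolding fl using floor_correct[of "2 ^ n * t"]
    by (simp add: pos_less_divide_eq mult.commute)
  have hi: "?\<rho> n \<le> t + inverse (2 ^ n)" for n
    unfolding fl using floor_correct[of "2 ^ n * t"]
    by (simp add: divide_simps algebra_simps)
  have "?\<rho> \<longlonglongrightarrow> t"
  proof (rule tendsto_sandwich[where f="\<lambda>_. t" and h="\<lambda>n. t + inverse (2 ^ n)"])
    show "(\<lambda>n. t + inverse (2 ^ n)) \<longlonglongrightarrow> t"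
      using tendsto_add[OF tendsto_const[of t] LIMSEQ_inverse_realpow_zero[of 2]] by simp
  qed (use lo hi in \<open>auto intro!: always_eventually less_imp_le\<close>)
  then show ?thesis
    using lo by (intro tendsto_imp_filterlim_at_right) (auto intro!: always_eventually)
qed

text \<open>
  The path at \<open>t\<close> is the limit of its values at the dyadic points to the right of \<open>t\<close>, and each
  approximation takes countably many random variables as values. Truncation at \<open>0\<close> is there
  because a process carries no information at negative times.
\<close>

lemma right_continuous_jointly_measurable:
  fixes X :: "real \<Rightarrow> 'w \<Rightarrow> real"
  assumes meas: "\<And>t. 0 \<le> t \<Longrightarrow> X t \<in> borel_measurable G"
    and rc: "\<And>w t. w \<in> space G \<Longrightarrow> 0 \<le> t \<Longrightarrow> ((\<lambda>s. X s w) \<longlongrightarrow> X t w) (at_right t)"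
  shows "(\<lambda>(t, w). X (max 0 t) w) \<in> borel_measurable (borel \<Otimes>\<^sub>M G)"
proof (rule borel_measurable_LIMSEQ_real)
  let ?k = "\<lambda>n (t :: real). nat \<lfloor>2 ^ n * max 0 t\<rfloor>"
  let ?u = "\<lambda>n (t, w). X ((real (?k n t) + 1) / 2 ^ n) w"
  show "?u n \<in> borel_measurable (borel \<Otimes>\<^sub>M G)" for n
  proof -
    have *: "(\<lambda>z. X ((real k + 1) / 2 ^ n) (snd z)) \<in> borel_measurable (borel \<Otimes>\<^sub>M G)" for k
      using meas[of "(real k + 1) / 2 ^ n"] by simp
    have "(\<lambda>z. ?k n (fst z)) \<in> measurable (borel \<Otimes>\<^sub>M G) (count_space UNIV)"
      by measurable
    from measurable_compose_countable[OF * this] show ?thesis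
      by (simp only: case_prod_beta')
  qed
  show "(\<lambda>n. ?u n z) \<longlonglongrightarrow> (case z of (t, w) \<Rightarrow> X (max 0 t) w)" if "z \<in> space (borel \<Otimes>\<^sub>M G)" for z
  proof -
    obtain t w where z: "z = (t, w)" by (cases z)
    have w: "w \<in> space G" using that by (simp add: z space_pair_measure)
    show ?thesis
      using filterlim_compose[OF rc[OF w, of "max 0 t"] filterlim_grid_at_right[of "max 0 t"]]
      by (simp add: z)
  qed
qed

context prob_space
begin

text \<open>
  The past up to \<open>a\<close> is generated by the union of the sigma-algebras of finitely many time
  points, which is directed and hence stable under intersection. For finitely many times,
  sorting them together with \<open>0\<close> and \<open>a\<close> expresses their values as partial sums of
  increments that all precede the increment from \<open>a\<close> to \<open>b\<close>.
\<close>

lemma levy_process_past_indep: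
  assumes L: "levy_process M X" and ab: "0 \<le> a" "a \<le> b"
  shows "indep_set (generated_events M borel {0..a} X)
           (generated_events M borel UNIV (\<lambda>_::unit. \<lambda>w. X b w - X a w))" (is "indep_set ?P ?F")
proof -
  let ?G = "\<lambda>S. generated_events M borel S X"
  define \<U> where "\<U> = {A. \<exists>S. finite S \<and> S \<subseteq> {0..a} \<and> A \<in> ?G S}"
  have X0: "X 0 w = 0" if "w \<in> space M" for w
    using L that by (auto simp: levy_process_def)
  have fin: "indep_set (?G S) ?F" if S: "finite S" "S \<subseteq> {0..a}" for S
  proof -
    define l where "l = sorted_list_of_set (insert 0 (insert a S))"
    define n where "n = length l - 1"
    \<comment> \<open>Beyond the sorted times the sequence stays at \<open>b\<close>, so increment number \<open>n\<close> is the one from \<open>a\<close> to \<open>b\<close>.\<close>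
    define t where "t k = (if k < length l then l ! k else b)" for k
    have setl: "set l = insert 0 (insert a S)"
      unfolding l_def using S by (intro set_sorted_list_of_set) auto
    have srt: "sorted l" by (simp add: l_def)
    have ne: "l \<noteq> []" using setl by auto
    then have len: "length l = Suc n" by (simp add: n_def)
    have rng: "0 \<le> x \<and> x \<le> a" if "x \<in> set l" for x
      using that setl S ab by auto
    have t0: "t 0 = 0"
    proof -
      obtain k where "k < length l" "l ! k = 0" using setl by (metis in_set_conv_nth insertI1)
      then have "l ! 0 \<le> 0" using sorted_nth_mono[OF srt, of 0 k] by simp
      moreover have "0 \<le> l ! 0" using rng[of "l ! 0"] ne by simp
      ultimately show ?thesis using ne by (simp add: t_def)
    qed
    have tn: "t n = a"
    proof -
      obtain k where "k < length l" "l ! k = a" using setl by (metis in_set_conv_nth insert_iff)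
      then have "a \<le> l ! n" using sorted_nth_mono[OF srt, of k n] len by simp
      moreover have "l ! n \<le> a" using rng[of "l ! n"] len by simp
      ultimately show ?thesis using len by (simp add: t_def)
    qed
    have tSn: "t (Suc n) = b" using len by (simp add: t_def)
    have "mono t"
      unfolding mono_def t_def using srt rng ab
      by (auto simp: sorted_iff_nth_mono intro: order_trans[OF _ ab(2)])
    define \<xi> where "\<xi> k w = X (t (Suc k)) w - X (t k) w" for k w
    have iv: "indep_vars (\<lambda>_. borel) \<xi> UNIV"
      using L \<open>mono t\<close> t0 unfolding levy_process_def indep_increments_def \<xi>_def by auto
    let ?H = "generated_algebra M borel {..<n} \<xi>"
    have step: "\<xi> k \<in> borel_measurable ?H" if "k < n" for k
      using that by (intro measurable_generated_algebra) auto
    have Xt: "X (t k) \<in> borel_measurable ?H" if "k \<le> n" for k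
      using that
    proof (induction k)
      case 0
      show ?case
        using measurable_cong[of ?H "X (t 0)" "\<lambda>_. 0" borel] by (simp add: t0 X0)
    next
      case (Suc k)
      have eq: "X (t (Suc k)) = (\<lambda>w. X (t k) w + \<xi> k w)" by (simp add: \<xi>_def)
      show ?case unfolding eq using Suc step[of k] by (intro borel_measurable_add) auto
    qed
    have "?G S \<subseteq> sets ?H"
    proof (rule generated_events_subset_sets)
      fix s assume "s \<in> S"
      then obtain k where "k < length l" "l ! k = s" using setl by (metis in_set_conv_nth insert_iff)
      then show "X s \<in> borel_measurable ?H" using Xt[of k] len by (simp add: t_def)
    qed simp
    moreover have "?F \<subseteq> generated_events M borel {n} \<xi>"
      by (intro generated_events_least sigma_algebra_generated_events)
         (auto intro!: generated_eventsI[of n "{n}" _ borel \<xi>, unfolded \<xi>_def tn tSn] simp: tn tSn \<xi>_def[abs_def])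
    ultimately show ?thesis
      using indep_set_mono[OF indep_set_sequence_past[OF iv, of n]] by simp
  qed
  have "indep_set \<U> ?F"
    using indep_setD_ev1[OF fin] indep_setD_ev2[OF fin[of "{}"]] indep_setD[OF fin]
    by (intro indep_setI) (auto simp: \<U>_def)
  moreover have "Int_stable \<U>"
  proof (rule Int_stableI)
    fix x y assume "x \<in> \<U>" "y \<in> \<U>"
    then obtain S S' where *: "finite (S \<union> S')" "S \<union> S' \<subseteq> {0..a}" "x \<in> ?G S" "y \<in> ?G S'"
      by (auto simp: \<U>_def)
    have "x \<in> ?G (S \<union> S')" "y \<in> ?G (S \<union> S')"
      using * generated_events_mono[of _ "S \<union> S'" M borel X] by blast+
    then have "x \<inter> y \<in> ?G (S \<union> S')"
      unfolding sets_generated_algebra[symmetric] by (rule sets.Int)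
    then show "x \<inter> y \<in> \<U>" using * unfolding \<U>_def by blast
  qed
  moreover have "Int_stable ?F"
    unfolding sets_generated_algebra[symmetric] by (rule sets.Int_stable)
  ultimately have "indep_set (sigma_sets (space M) \<U>) (sigma_sets (space M) ?F)"
    by (rule indep_set_sigma_sets)
  moreover have "?P \<subseteq> sigma_sets (space M) \<U>"
  proof (rule generated_events_least)
    show "sigma_algebra (space M) (sigma_sets (space M) \<U>)"
      using indep_setD_ev1[OF \<open>indep_set \<U> ?F\<close>] sets.space_closed
      by (intro sigma_algebra_sigma_sets) auto
    fix t and A :: "real set" assume "t \<in> {0..a}" "A \<in> sets borel"
    then have "X t -` A \<inter> space M \<in> \<U>"
      unfolding \<U>_def by (auto intro!: exI[of _ "{t}"] generated_eventsI)
    then show "X t -` A \<inter> space M \<in> sigma_sets (space M) \<U>" by auto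
  qed
  ultimately show ?thesis by (rule indep_set_mono) auto
qed

lemma levy_process_exp_moment_add:
  assumes L: "levy_process M X" and st: "0 \<le> s" "0 \<le> t"
  shows "(\<integral>\<^sup>+w. ennreal (exp (\<omega> * X (s + t) w)) \<partial>M) =
    (\<integral>\<^sup>+w. ennreal (exp (\<omega> * X s w)) \<partial>M) * (\<integral>\<^sup>+w. ennreal (exp (\<omega> * X t w)) \<partial>M)"
proof -
  have [measurable]: "X s \<in> borel_measurable M" "X t \<in> borel_measurable M" "X (s + t) \<in> borel_measurable M"
    using L st by (auto simp: levy_process_def)
  have stat: "distr M borel (\<lambda>w. X (s + t) w - X s w) = distr M borel (X t)"
    using L st by (auto simp: levy_process_def)
  let ?G = "generated_algebra M borel {0..s} X"
  let ?H = "generated_algebra M borel UNIV (\<lambda>_::unit. \<lambda>w. X (s + t) w - X s w)"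
  have "X s \<in> borel_measurable ?G" "(\<lambda>w. X (s + t) w - X s w) \<in> borel_measurable ?H"
    using st by (auto intro: measurable_generated_algebra)
  then have [measurable]: "(\<lambda>w. exp (\<omega> * X s w)) \<in> borel_measurable ?G"
    "(\<lambda>w. exp (\<omega> * (X (s + t) w - X s w))) \<in> borel_measurable ?H" by measurable
  have "(\<integral>\<^sup>+w. ennreal (exp (\<omega> * X (s + t) w)) \<partial>M) =
     (\<integral>\<^sup>+w. ennreal (exp (\<omega> * X s w)) * ennreal (exp (\<omega> * (X (s + t) w - X s w))) \<partial>M)"
    by (intro nn_integral_cong) (simp add: ennreal_mult'[symmetric] exp_add[symmetric] algebra_simps)
  also have "\<dots> = (\<integral>\<^sup>+w. ennreal (exp (\<omega> * X s w)) \<partial>M) *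
      (\<integral>\<^sup>+w. ennreal (exp (\<omega> * (X (s + t) w - X s w))) \<partial>M)"
  proof (rule nn_integral_indep_mult)
    show "subalgebra M ?G" using L by (intro subalgebra_generated_algebra) (auto simp: levy_process_def)
    show "subalgebra M ?H" by (intro subalgebra_generated_algebra) auto
    show "indep_set (sets ?G) (sets ?H)"
      using levy_process_past_indep[OF L, of s "s + t"] st by simp
  qed measurable
  also have "(\<integral>\<^sup>+w. ennreal (exp (\<omega> * (X (s + t) w - X s w))) \<partial>M) =
      (\<integral>\<^sup>+x. ennreal (exp (\<omega> * x)) \<partial>distr M borel (\<lambda>w. X (s + t) w - X s w))"
    by (subst nn_integral_distr) auto
  also have "\<dots> = (\<integral>\<^sup>+w. ennreal (exp (\<omega> * X t w)) \<partial>M)"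
    unfolding stat by (subst nn_integral_distr) auto
  finally show ?thesis .
qed

text \<open>
  The moment \<open>m t\<close> turns sums into products, so \<open>m t = exp (t \<phi>)\<close> at dyadic \<open>t\<close>.
  Right-continuity and Fatou's lemma give \<open>m t \<le> exp (t \<phi>)\<close> for every \<open>t\<close>. The reverse
  inequality follows by applying this bound to the complementary time \<open>n - t\<close> in
  \<open>m n = m t * m (n - t)\<close>.
\<close>

lemma levy_process_exp_moment:
  assumes L: "levy_process M X" and fin: "laplace_finite M X (- \<omega>)" and "0 \<le> t"
  shows "(\<integral>\<^sup>+w. ennreal (exp (\<omega> * X t w)) \<partial>M) = ennreal (exp (t * laplace_exponent M X (- \<omega>)))"
proof -
  define \<phi> where "\<phi> = laplace_exponent M X (- \<omega>)"
  define m where "m t = (\<integral>\<^sup>+w. ennreal (exp (\<omega> * X t w)) \<partial>M)" for t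
  have meas[measurable]: "X t \<in> borel_measurable M" if "0 \<le> t" for t
    using L that by (auto simp: levy_process_def)
  have add: "m (s + t) = m s * m t" if "0 \<le> s" "0 \<le> t" for s t
    unfolding m_def by (rule levy_process_exp_moment_add[OF L that])
  have m0: "m 0 = 1"
  proof -
    have "m 0 = (\<integral>\<^sup>+w. 1 \<partial>M)"
      unfolding m_def using L by (intro nn_integral_cong) (auto simp: levy_process_def)
    then show ?thesis by (simp add: emeasure_space_1)
  qed
  have int: "integrable M (\<lambda>w. exp (\<omega> * X 1 w))"
    using fin by (simp add: laplace_finite_def)
  have pos: "0 < (\<integral>w. exp (\<omega> * X 1 w) \<partial>M)"
    using integral_less_AE_space[of "\<lambda>_. 0" "\<lambda>w. exp (\<omega> * X 1 w)"] int emeasure_space_1 by simp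
  have m1: "m 1 = ennreal (exp \<phi>)"
    unfolding m_def \<phi>_def laplace_exponent_def using pos int
    by (simp add: nn_integral_eq_integral)
  have mult: "m (real k * t) = m t ^ k" if "0 \<le> t" for k t
    using that by (induction k) (simp_all add: m0 add algebra_simps)
  have rat: "m (real k / 2 ^ n) = ennreal (exp (real k / 2 ^ n * \<phi>))" for k n
  proof -
    let ?t = "real k / 2 ^ n"
    have "m ?t ^ (2 ^ n) = m (real k * 1)"
      using mult[of ?t "2 ^ n"] by (simp)
    also have "\<dots> = ennreal (exp (real k * \<phi>))"
      using mult[of 1 k] m1 by (simp add: ennreal_power exp_of_nat_mult)
    finally have pw: "m ?t ^ (2 ^ n) = ennreal (exp (real k * \<phi>))" .
    then obtain r where r: "m ?t = ennreal r" "0 \<le> r"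
      by (cases "m ?t") (auto simp: power_eq_top_ennreal)
    have "r ^ (2 ^ n) = exp (?t * \<phi>) ^ (2 ^ n)"
      using pw r by (simp add: ennreal_power exp_of_nat_mult[symmetric])
    then have "r = exp (?t * \<phi>)"
      using r(2) power_eq_iff_eq_base[of "2 ^ n" r "exp (?t * \<phi>)"] by simp
    then show ?thesis using r by simp
  qed
  have upper: "m t \<le> ennreal (exp (t * \<phi>))" if t: "0 \<le> t" for t
  proof -
    let ?\<rho> = "\<lambda>n. (real (nat \<lfloor>2 ^ n * t\<rfloor>) + 1) / 2 ^ n"
    note \<rho> = filterlim_grid_at_right[OF t]
    have nonneg: "0 \<le> ?\<rho> n" for n by simp
    have "m t = (\<integral>\<^sup>+w. liminf (\<lambda>n. ennreal (exp (\<omega> * X (?\<rho> n) w))) \<partial>M)"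
      unfolding m_def
    proof (intro nn_integral_cong)
      fix w assume "w \<in> space M"
      then have "((\<lambda>s. X s w) \<longlongrightarrow> X t w) (at_right t)"
        using L t by (auto simp: levy_process_def)
      then have "(\<lambda>n. X (?\<rho> n) w) \<longlonglongrightarrow> X t w"
        by (rule filterlim_compose[OF _ \<rho>])
      then have "(\<lambda>n. ennreal (exp (\<omega> * X (?\<rho> n) w))) \<longlonglongrightarrow> ennreal (exp (\<omega> * X t w))"
        by (intro tendsto_intros)
      then show "ennreal (exp (\<omega> * X t w)) = liminf (\<lambda>n. ennreal (exp (\<omega> * X (?\<rho> n) w)))"
        by (intro lim_imp_Liminf[symmetric]) auto
    qed
    also have "\<dots> \<le> liminf (\<lambda>n. m (?\<rho> n))"
      unfolding m_def using meas[OF nonneg] by (intro nn_integral_liminf) auto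
    also have "(\<lambda>n. m (?\<rho> n)) = (\<lambda>n. ennreal (exp (?\<rho> n * \<phi>)))"
      using rat[of "Suc (nat \<lfloor>2 ^ n * t\<rfloor>)" n for n]
      by (simp add: add.commute)
    also have "liminf \<dots> = ennreal (exp (t * \<phi>))"
      using \<rho> by (intro lim_imp_Liminf tendsto_intros) (auto simp: filterlim_at)
    finally show ?thesis .
  qed
  have "m t = ennreal (exp (t * \<phi>))" if t: "0 \<le> t" for t
  proof -
    define n where "n = nat \<lceil>t\<rceil>"
    have n: "t \<le> real n" unfolding n_def by linarith
    have "ennreal (exp (t * \<phi>)) * ennreal (exp ((real n - t) * \<phi>)) = m (real n)"
      using rat[of n 0] by (simp add: ennreal_mult'[symmetric] exp_add[symmetric] algebra_simps)
    also have "\<dots> = m t * m (real n - t)"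
      using add[of t "real n - t"] t n by simp
    also have "\<dots> \<le> m t * ennreal (exp ((real n - t) * \<phi>))"
      using upper[of "real n - t"] n by (intro mult_left_mono) auto
    finally have "ennreal (exp (t * \<phi>)) \<le> m t"
      by (subst (asm) (1 2) mult.commute, subst (asm) ennreal_mult_le_mult_iff) auto
    then show ?thesis using upper[OF t] by simp
  qed
  then show ?thesis using assms(3) by (simp add: m_def \<phi>_def)
qed

end

section \<open>The sources of randomness of the resampled model\<close>

text \<open>
  Lack of memory: on \<open>s < S\<close> the residual \<open>S - s\<close> is exponential again, so the moment
  \<open>q / (q - \<phi>)\<close> of a full cycle appears, weighted with the survival probability.
\<close>

lemma (in prob_space) exponential_residual_exp_moment:
  fixes S :: "'a \<Rightarrow> real"
  assumes D: "distributed M lborel S (\<lambda>x. ennreal (exponential_density q x))"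
    and q: "0 < q" "\<phi> < q" and s: "0 \<le> s"
  shows "(\<integral>\<^sup>+w. (if s < S w then ennreal (exp ((S w - s) * \<phi>)) else 0) \<partial>M) =
    ennreal (q / (q - \<phi>)) * ennreal (exp (- s * q))"
proof -
  let ?g = "\<lambda>x. if s < x then ennreal (exp ((x - s) * \<phi>)) else 0"
  interpret E: prob_space "density lborel (exponential_density (q - \<phi>))"
    using q by (intro prob_space_exponential_density) simp
  have one: "(\<integral>\<^sup>+x. ennreal (exponential_density (q - \<phi>) x) \<partial>lborel) = 1"
    using E.emeasure_space_1 by (simp add: emeasure_density)
  have "(\<integral>\<^sup>+w. ?g (S w) \<partial>M) = (\<integral>\<^sup>+x. ennreal (exponential_density q x) * ?g x \<partial>lborel)"
    by (rule distributed_nn_integral[OF D, symmetric]) measurable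
  also have "\<dots> = (\<integral>\<^sup>+x. ennreal (exponential_density q (s + x)) * ?g (s + x) \<partial>lborel)"
    by (subst nn_integral_real_affine[where c=1 and t=s]) (auto cong: if_cong)
  also have "\<dots> = (\<integral>\<^sup>+x. ennreal (q / (q - \<phi>) * exp (- s * q)) *
      ennreal (exponential_density (q - \<phi>) x) \<partial>lborel)"
  \<comment> \<open>The two integrands agree except possibly at the boundary point \<open>0\<close> of the density.\<close>
  proof (rule nn_integral_cong_AE, rule AE_mp[OF AE_lborel_singleton[of 0]], intro AE_I2 impI)
    fix x :: real assume "x \<noteq> 0"
    show "ennreal (exponential_density q (s + x)) * ?g (s + x) =
      ennreal (q / (q - \<phi>) * exp (- s * q)) * ennreal (exponential_density (q - \<phi>) x)"
    proof (cases "0 < x")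
      case True
      then have "exponential_density q (s + x) * exp (x * \<phi>) =
        q / (q - \<phi>) * exp (- s * q) * exponential_density (q - \<phi>) x"
        using s q by (simp add: exponential_density_def exp_add[symmetric] mult.assoc[symmetric])
           (simp add: algebra_simps exp_add[symmetric])
      then show ?thesis
        using True q by (simp add: ennreal_mult'[symmetric] ennreal_mult''[symmetric])
    next
      case False
      then show ?thesis using \<open>x \<noteq> 0\<close> by (simp add: exponential_density_def)
    qed
  qed
  also have "\<dots> = ennreal (q / (q - \<phi>) * exp (- s * q))"
    by (simp add: nn_integral_cmult one)
  finally show ?thesis using q by (simp add: ennreal_mult''[symmetric])
qed

text \<open>
  The abstract setting of the maximal inequality: independent Levy sources with a finite
  exponential moment at \<open>\<omega>\<close>, resampled at the epochs of a Poisson process whose rate exceeds all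
  Laplace exponents at \<open>-\<omega>\<close>.
\<close>

locale resampled_levy = prob_space M for M :: "'w measure" +
  fixes d :: nat and q \<omega> :: real and p :: "nat \<Rightarrow> real"
    and X :: "nat \<Rightarrow> real \<Rightarrow> 'w \<Rightarrow> real" and T :: "nat \<Rightarrow> 'w \<Rightarrow> real" and J :: "nat \<Rightarrow> 'w \<Rightarrow> nat"
  assumes q_pos: "0 < q"
    and levy: "i \<in> {1..d} \<Longrightarrow> levy_process M (X i)"
    and epochs: "poisson_epochs M q T"
    and regime_measurable: "J n \<in> measurable M (count_space UNIV)"
    and regime_range: "w \<in> space M \<Longrightarrow> J n w \<in> {1..d}"
    and regime_law: "i \<in> {1..d} \<Longrightarrow> measure M {w \<in> space M. J n w = i} = p i"
    and regime_indep: "indep_vars (\<lambda>_. count_space UNIV) J UNIV"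
    and sources_indep: "indep_sets (source_events M X T J) (Levy ` {1..d} \<union> {Clock, Regime})"
    and tilt_finite: "i \<in> {1..d} \<Longrightarrow> laplace_finite M (X i) (- \<omega>)"
    and tilt_below_rate: "i \<in> {1..d} \<Longrightarrow> laplace_exponent M (X i) (- \<omega>) < q"
begin

definition tilt :: "nat \<Rightarrow> real" where "tilt i = laplace_exponent M (X i) (- \<omega>)"

text \<open>
  The factor \<open>h\<^sub>i\<close>, the \<open>\<omega>\<close>-exponential moment of the increment over a full cycle in regime \<open>i\<close>.
\<close>

definition cycle_moment :: "nat \<Rightarrow> real" where "cycle_moment i = q / (q - tilt i)"

lemma cycle_moment_pos: "i \<in> {1..d} \<Longrightarrow> 0 < cycle_moment i"
  using q_pos tilt_below_rate by (simp add: cycle_moment_def tilt_def)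

definition paths :: "'w measure" where
  "paths = generated_algebra M borel ({1..d} \<times> {0..}) (\<lambda>(i, t). X i t)"

definition paths_upto :: "real \<Rightarrow> 'w measure" where
  "paths_upto a = generated_algebra M borel ({1..d} \<times> {0..a}) (\<lambda>(i, t). X i t)"

definition clock :: "'w measure" where "clock = generated_algebra M borel UNIV T"

definition clock_upto :: "nat \<Rightarrow> 'w measure" where
  "clock_upto n = generated_algebra M borel {..n} T"

definition regime :: "'w measure" where "regime = generated_algebra M (count_space UNIV) UNIV J"

definition regime_before :: "nat \<Rightarrow> 'w measure" where
  "regime_before n = generated_algebra M (count_space UNIV) {..<n} J"

abbreviation environment :: "'w measure" where "environment \<equiv> join_algebra regime clock"

abbreviation regime_clock_upto :: "nat \<Rightarrow> 'w measure" where
  "regime_clock_upto n \<equiv> join_algebra regime (clock_upto n)"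

abbreviation clock_regime_before :: "nat \<Rightarrow> 'w measure" where
  "clock_regime_before n \<equiv> join_algebra clock (regime_before n)"

lemma space_algebras [simp]:
  "space paths = space M" "space (paths_upto a) = space M"
  "space clock = space M" "space (clock_upto n) = space M"
  "space regime = space M" "space (regime_before n) = space M"
  by (simp_all add: paths_def paths_upto_def clock_def clock_upto_def regime_def regime_before_def)

lemma path_measurable: "i \<in> {1..d} \<Longrightarrow> 0 \<le> t \<Longrightarrow> X i t \<in> borel_measurable M"
  using levy by (simp add: levy_process_def)

lemma epoch_measurable: "T n \<in> borel_measurable M"
  using epochs by (simp add: poisson_epochs_def)

lemma epoch_zero: "w \<in> space M \<Longrightarrow> T 0 w = 0"
  using epochs by (simp add: poisson_epochs_def)

lemma epoch_strict_mono: "w \<in> space M \<Longrightarrow> strict_mono (\<lambda>n. T n w)"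
  using epochs by (simp add: poisson_epochs_def)

lemma epoch_Suc_less: "w \<in> space M \<Longrightarrow> T n w < T (Suc n) w"
  using epoch_strict_mono by (simp add: strict_mono_Suc_iff)

lemma epoch_mono: "w \<in> space M \<Longrightarrow> m \<le> n \<Longrightarrow> T m w \<le> T n w"
  using epoch_strict_mono[of w] strict_mono_less_eq[of "\<lambda>n. T n w"] by simp

lemma epoch_nonneg: "w \<in> space M \<Longrightarrow> 0 \<le> T n w"
  using epoch_mono[of w 0 n] epoch_zero[of w] by simp

lemma cycle_length_distributed:
  "distributed M lborel (\<lambda>w. T (Suc n) w - T n w) (\<lambda>x. ennreal (exponential_density q x))"
  using epochs by (simp add: poisson_epochs_def)

lemma subalgebra_paths: "subalgebra M paths" "subalgebra M (paths_upto a)"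
  unfolding paths_def paths_upto_def
  by (intro subalgebra_generated_algebra; auto intro: path_measurable)+

lemma subalgebra_clock: "subalgebra M clock" "subalgebra M (clock_upto n)"
  unfolding clock_def clock_upto_def
  by (intro subalgebra_generated_algebra; auto intro: epoch_measurable)+

lemma subalgebra_regime: "subalgebra M regime" "subalgebra M (regime_before n)"
  unfolding regime_def regime_before_def
  by (intro subalgebra_generated_algebra; auto intro: regime_measurable)+

lemmas subalgebra_environment =
  subalgebra_join_algebra[OF subalgebra_regime(1) subalgebra_clock(1)]
  subalgebra_join_algebra[OF subalgebra_regime(1) subalgebra_clock(2)]
  subalgebra_join_algebra[OF subalgebra_clock(1) subalgebra_regime(2)]

lemma path_measurable_paths:
  "i \<in> {1..d} \<Longrightarrow> 0 \<le> t \<Longrightarrow> X i t \<in> borel_measurable paths"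
  "i \<in> {1..d} \<Longrightarrow> 0 \<le> t \<Longrightarrow> t \<le> a \<Longrightarrow> X i t \<in> borel_measurable (paths_upto a)"
  unfolding paths_def paths_upto_def
  using measurable_generated_algebra[of "(i, t)" "{1..d} \<times> {0..}" "\<lambda>(i, t). X i t" M borel]
        measurable_generated_algebra[of "(i, t)" "{1..d} \<times> {0..a}" "\<lambda>(i, t). X i t" M borel]
  by auto

lemma epoch_measurable_clock:
  "T n \<in> borel_measurable clock" "m \<le> n \<Longrightarrow> T m \<in> borel_measurable (clock_upto n)"
  unfolding clock_def clock_upto_def by (intro measurable_generated_algebra; auto)+

lemma regime_measurable_regime:
  "J n \<in> measurable regime (count_space UNIV)"
  "m < n \<Longrightarrow> J m \<in> measurable (regime_before n) (count_space UNIV)"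
  unfolding regime_def regime_before_def by (intro measurable_generated_algebra; auto)+

lemma measurable_environment:
  "T n \<in> borel_measurable environment" "J n \<in> measurable environment (count_space UNIV)"
  "m \<le> n \<Longrightarrow> T m \<in> borel_measurable (regime_clock_upto n)"
  "J k \<in> measurable (regime_clock_upto n) (count_space UNIV)"
  "T k \<in> borel_measurable (clock_regime_before n)"
  "m < n \<Longrightarrow> J m \<in> measurable (clock_regime_before n) (count_space UNIV)"
  by (auto intro: measurable_join_algebra1 measurable_join_algebra2 epoch_measurable_clock
      regime_measurable_regime)

lemma Int_stable_source_events: "Int_stable (source_events M X T J c)"
  by (cases c) (simp_all add: source_events_def Int_stable_generated_events)

lemma source_events_subset_Pow: "source_events M X T J c \<subseteq> Pow (space M)"
  by (cases c) (simp_all add: source_events_def generated_events_subset_Pow)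

lemma indep_groups:
  assumes "I1 \<subseteq> Levy ` {1..d} \<union> {Clock, Regime}" "I2 \<subseteq> Levy ` {1..d} \<union> {Clock, Regime}" "I1 \<inter> I2 = {}"
  shows "indep_set (sigma_sets (space M) (\<Union>c\<in>I1. source_events M X T J c))
    (sigma_sets (space M) (\<Union>c\<in>I2. source_events M X T J c))"
  using indep_sets_grouped[OF sources_indep Int_stable_source_events] assms .

lemma paths_events_subset:
  assumes "I \<subseteq> {1..d}"
  shows "generated_events M borel (I \<times> {0..}) (\<lambda>(i, t). X i t)
    \<subseteq> sigma_sets (space M) (\<Union>c\<in>Levy ` I. source_events M X T J c)"
proof (rule generated_events_least)
  show "sigma_algebra (space M) (sigma_sets (space M) (\<Union>c\<in>Levy ` I. source_events M X T J c))"
    using source_events_subset_Pow by (intro sigma_algebra_sigma_sets) auto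
  fix z :: "nat \<times> real" and A :: "real set" assume z: "z \<in> I \<times> {0..}" "A \<in> sets borel"
  then have "X (fst z) (snd z) -` A \<inter> space M \<in> source_events M X T J (Levy (fst z))"
    by (auto simp: source_events_def intro!: generated_eventsI)
  then show "(case z of (i, t) \<Rightarrow> X i t) -` A \<inter> space M
      \<in> sigma_sets (space M) (\<Union>c\<in>Levy ` I. source_events M X T J c)"
    using z by (auto simp: case_prod_beta intro!: sigma_sets.Basic)
qed

lemma indep_paths_environment: "indep_set (sets paths) (sets environment)"
proof (rule indep_set_mono[OF indep_groups[of "Levy ` {1..d}" "{Clock, Regime}"]])
  show "sets paths \<subseteq> sigma_sets (space M) (\<Union>c\<in>Levy ` {1..d}. source_events M X T J c)"
    using paths_events_subset[of "{1..d}"] by (simp add: paths_def)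
  show "sets environment \<subseteq> sigma_sets (space M) (\<Union>c\<in>{Clock, Regime}. source_events M X T J c)"
    by (auto simp: sets_join_algebra regime_def clock_def source_events_def Un_commute)
qed auto

lemma indep_regime_clock: "indep_set (sets regime) (sets clock)"
  by (rule indep_set_mono[OF indep_groups[of "{Regime}" "{Clock}"]])
     (auto simp: regime_def clock_def source_events_def)

text \<open>
  The past consists of the past of source \<open>i\<close> itself and of parts of the other sources, which
  are independent of all of source \<open>i\<close>; a past of all sources together is needed because earlier
  cycles may have used any of them.
\<close>

lemma indep_past_increment:
  assumes i: "i \<in> {1..d}" and ab: "0 \<le> a" "a \<le> b"
  shows "indep_set (sets (paths_upto a))
    (generated_events M borel UNIV (\<lambda>_::unit. \<lambda>w. X i b w - X i a w))"
proof -
  let ?C = "generated_algebra M borel (({1..d} - {i}) \<times> {0..}) (\<lambda>(i, t). X i t)"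
  let ?E = "generated_algebra M borel {0..} (X i)"
  let ?P = "generated_algebra M borel {0..a} (X i)"
  let ?F = "generated_algebra M borel UNIV (\<lambda>_::unit. \<lambda>w. X i b w - X i a w)"
  have Xi: "X i t \<in> borel_measurable ?E" if "0 \<le> t" for t
    using that by (intro measurable_generated_algebra) auto
  have "indep_set (sets (join_algebra ?C ?P)) (sets ?F)"
  proof (rule indep_set_join_algebra[where E = ?E])
    show "indep_set (sets ?C) (sets ?E)"
      by (rule indep_set_mono[OF indep_groups[of "Levy ` ({1..d} - {i})" "{Levy i}"]])
         (use i paths_events_subset[of "{1..d} - {i}"] in \<open>auto simp: source_events_def\<close>)
    show "indep_set (sets ?P) (sets ?F)"
      using levy_process_past_indep[OF levy[OF i] ab] by simp
    show "subalgebra M ?C" "subalgebra M ?E"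
      using i by (auto intro!: subalgebra_generated_algebra path_measurable)
    show "subalgebra ?E ?P"
      by (simp add: subalgebra_def generated_events_mono)
    show "subalgebra ?E ?F"
      using Xi[of a] Xi[of b] ab generated_events_subset_sets[of ?E M UNIV "\<lambda>_::unit. \<lambda>w. X i b w - X i a w" borel]
      by (simp add: subalgebra_def)
  qed
  moreover have "sets (paths_upto a) \<subseteq> sets (join_algebra ?C ?P)"
    unfolding paths_upto_def sets_generated_algebra[of M borel "{1..d} \<times> {0..a}"]
  proof (rule generated_events_subset_sets)
    fix z assume z: "z \<in> {1..d} \<times> {0..a}"
    obtain j t where zz: "z = (j, t)" by (cases z)
    have j: "j \<in> {1..d}" "t \<in> {0..a}" using z zz by auto
    show "(case z of (j, t) \<Rightarrow> X j t) \<in> borel_measurable (join_algebra ?C ?P)"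
    proof (cases "j = i")
      case True
      have "X i t \<in> borel_measurable ?P" using j by (intro measurable_generated_algebra) auto
      then show ?thesis using True zz by (simp add: measurable_join_algebra2)
    next
      case False
      then have "X j t \<in> borel_measurable ?C"
        using j measurable_generated_algebra[of "(j, t)" "({1..d} - {i}) \<times> {0..}" "\<lambda>(i, t). X i t" M borel]
        by auto
      then show ?thesis using zz by (simp add: measurable_join_algebra1)
    qed
  qed simp
  ultimately show ?thesis by (auto elim: indep_set_mono)
qed

text \<open>
  All regimes may be adjoined to the past epochs, as the clock is independent of them.
\<close>

lemma indep_past_cycle_length:
  "indep_set (sets (regime_clock_upto n))
    (generated_events M borel UNIV (\<lambda>_::unit. \<lambda>w. T (Suc n) w - T n w))"
proof -
  let ?\<xi> = "\<lambda>n w. T (Suc n) w - T n w"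
  let ?F = "generated_algebra M borel UNIV (\<lambda>_::unit. ?\<xi> n)"
  let ?H = "generated_algebra M borel {..<n} ?\<xi>"
  have "T m \<in> borel_measurable ?H" if "m \<le> n" for m
    using that
  proof (induction m)
    case 0
    show ?case using measurable_cong[of ?H "T 0" "\<lambda>_. 0" borel] by (simp add: epoch_zero)
  next
    case (Suc m)
    have eq: "T (Suc m) = (\<lambda>w. T m w + ?\<xi> m w)" by simp
    have "?\<xi> m \<in> borel_measurable ?H" using Suc by (intro measurable_generated_algebra) auto
    then show ?case using Suc by (subst eq, intro borel_measurable_add) auto
  qed
  then have "sets (clock_upto n) \<subseteq> sets ?H"
    unfolding clock_upto_def sets_generated_algebra[of M borel "{..n}"]
    by (intro generated_events_subset_sets) auto
  moreover have "sets ?F \<subseteq> generated_events M borel {n} ?\<xi>"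
    unfolding sets_generated_algebra
    by (intro generated_events_least sigma_algebra_generated_events)
       (auto intro!: generated_eventsI[of n "{n}" _ borel ?\<xi>])
  moreover have "indep_set (generated_events M borel {..<n} ?\<xi>) (generated_events M borel {n} ?\<xi>)"
    using epochs by (intro indep_set_sequence_past) (simp add: poisson_epochs_def)
  ultimately have PF: "indep_set (sets (clock_upto n)) (sets ?F)"
    by (auto elim: indep_set_mono)
  have "indep_set (sets (regime_clock_upto n)) (sets ?F)"
  proof (rule indep_set_join_algebra[OF indep_regime_clock PF])
    show "subalgebra clock (clock_upto n)"
      by (simp add: subalgebra_def) (simp add: clock_def clock_upto_def generated_events_mono)
    show "subalgebra clock ?F"
      using generated_events_subset_sets[of clock M UNIV "\<lambda>_::unit. ?\<xi> n" borel] epoch_measurable_clock(1)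
      by (simp add: subalgebra_def)
  qed (simp_all add: subalgebra_regime subalgebra_clock)
  then show ?thesis by simp
qed

lemma indep_past_regime:
  "indep_set (sets (clock_regime_before n)) (generated_events M (count_space UNIV) {n} J)"
proof -
  let ?F = "generated_algebra M (count_space UNIV) {n} J"
  have "indep_set (sets (clock_regime_before n)) (sets ?F)"
  proof (rule indep_set_join_algebra[OF indep_set_sym[OF indep_regime_clock]])
    show "indep_set (sets (regime_before n)) (sets ?F)"
      using indep_set_sequence_past[OF regime_indep, of n] by (simp add: regime_before_def)
    show "subalgebra regime (regime_before n)"
      by (simp add: subalgebra_def) (simp add: regime_def regime_before_def generated_events_mono)
    show "subalgebra regime ?F"
      by (simp add: subalgebra_def) (simp add: regime_def generated_events_mono)
  qed (simp_all add: subalgebra_regime subalgebra_clock)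
  then show ?thesis by simp
qed

section \<open>Measurability along the cycles\<close>

text \<open>
  Clock and regime enter through the second component only. There are countably many regimes,
  and the random time is absorbed by joint measurability of each path.
\<close>

lemma path_at_random_time_measurable:
  assumes sp: "space K = space M"
    and jm: "j \<in> measurable K (count_space UNIV)" "\<And>w. w \<in> space M \<Longrightarrow> j w \<in> {1..d}"
    and tm: "\<tau> \<in> borel_measurable K" "\<And>w. w \<in> space M \<Longrightarrow> 0 \<le> \<tau> w"
  shows "(\<lambda>z. X (j (snd z)) (\<tau> (snd z)) (fst z)) \<in> borel_measurable (paths \<Otimes>\<^sub>M K)"
proof -
  note jm(1)[measurable] tm(1)[measurable]
  have *: "(\<lambda>z. X i (max 0 (\<tau> (snd z))) (fst z)) \<in> borel_measurable (paths \<Otimes>\<^sub>M K)" if i: "i \<in> {1..d}" for i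
  proof -
    have "(\<lambda>(t, w). X i (max 0 t) w) \<in> borel_measurable (borel \<Otimes>\<^sub>M paths)"
      using levy[OF i] path_measurable_paths(1)[OF i]
      by (intro right_continuous_jointly_measurable) (auto simp: levy_process_def)
    then have "(\<lambda>z. case (\<tau> (snd z), fst z) of (t, w) \<Rightarrow> X i (max 0 t) w) \<in> borel_measurable (paths \<Otimes>\<^sub>M K)"
      by (rule measurable_compose[rotated]) measurable
    then show ?thesis by simp
  qed
  have "(\<lambda>z. j (snd z)) \<in> measurable (paths \<Otimes>\<^sub>M K) (count_space {1..d})"
    by (rule measurable_count_space_extend[OF subset_UNIV])
       (use jm(2) sp in \<open>auto simp: space_pair_measure\<close>)
  from measurable_compose_countable'[OF * this]
  have "(\<lambda>z. X (j (snd z)) (max 0 (\<tau> (snd z))) (fst z)) \<in> borel_measurable (paths \<Otimes>\<^sub>M K)" by simp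
  then show ?thesis
    by (rule measurable_cong[THEN iffD1, rotated]) (use tm(2) sp in \<open>auto simp: space_pair_measure\<close>)
qed

text \<open>
  The value at epoch \<open>n\<close>, with the paths read at \<open>w1\<close> and epochs and regimes at \<open>w2\<close>.
\<close>

definition start :: "nat \<Rightarrow> 'w \<Rightarrow> 'w \<Rightarrow> real" where
  "start n w1 w2 = resampled_at_epoch (\<lambda>i t _. X i t w1) T J n w2"

text \<open>
  The same at time \<open>s\<close> after epoch \<open>n\<close>, provided that the cycle is still running by then.
\<close>

definition position :: "nat \<Rightarrow> real \<Rightarrow> 'w \<Rightarrow> 'w \<Rightarrow> real" where
  "position n s w1 w2 = start n w1 w2 + (X (J n w2) (T n w2 + s) w1 - X (J n w2) (T n w2) w1)"

text \<open>
  The condition on the cycle length keeps grid points beyond the end of the cycle out of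
  consideration, so a crossing is a genuine excursion of the resampled process above \<open>v\<close>.
\<close>

definition crosses :: "real \<Rightarrow> real \<Rightarrow> nat \<Rightarrow> nat \<Rightarrow> 'w \<Rightarrow> 'w \<Rightarrow> bool" where
  "crosses \<delta> v n k w1 w2 \<longleftrightarrow>
    real k * \<delta> < T (Suc n) w2 - T n w2 \<and> v < position n (real k * \<delta>) w1 w2"

definition clear :: "real \<Rightarrow> real \<Rightarrow> nat \<Rightarrow> 'w \<Rightarrow> 'w \<Rightarrow> bool" where
  "clear \<delta> v n w1 w2 \<longleftrightarrow> (\<forall>l<n. \<forall>k. \<not> crosses \<delta> v l k w1 w2)"

lemma start_0 [simp]: "start 0 w1 w2 = 0"
  by (simp add: start_def)

lemma start_Suc: "start (Suc n) w1 w2 = position n (T (Suc n) w2 - T n w2) w1 w2"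
  by (simp add: start_def position_def)

lemma start_diagonal: "start n w w = resampled_at_epoch X T J n w"
  by (induction n) (simp_all add: start_def)

lemma position_measurable:
  assumes sp: "space K = space M" and "0 \<le> s"
    and "T n \<in> borel_measurable K" "J n \<in> measurable K (count_space UNIV)"
    and st: "(\<lambda>z. start n (fst z) (snd z)) \<in> borel_measurable (paths \<Otimes>\<^sub>M K)"
  shows "(\<lambda>z. position n s (fst z) (snd z)) \<in> borel_measurable (paths \<Otimes>\<^sub>M K)"
  unfolding position_def
  using path_at_random_time_measurable[OF sp, of "J n" "\<lambda>w. T n w + s"]
    path_at_random_time_measurable[OF sp, of "J n" "T n"] assms regime_range epoch_nonneg
  by (intro borel_measurable_add borel_measurable_diff st) auto

lemma start_measurable:
  assumes sp: "space K = space M"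
    and "\<And>l. l \<le> n \<Longrightarrow> T l \<in> borel_measurable K"
    and "\<And>l. l < n \<Longrightarrow> J l \<in> measurable K (count_space UNIV)"
  shows "(\<lambda>z. start n (fst z) (snd z)) \<in> borel_measurable (paths \<Otimes>\<^sub>M K)"
  using assms(2,3)
proof (induction n)
  case (Suc n)
  have "(\<lambda>z. X (J n (snd z)) (T l (snd z)) (fst z)) \<in> borel_measurable (paths \<Otimes>\<^sub>M K)" if "l \<le> Suc n" for l
    using Suc.prems that regime_range epoch_nonneg
    by (intro path_at_random_time_measurable[OF sp]) auto
  then show ?case
    unfolding start_Suc position_def using Suc by (intro borel_measurable_add borel_measurable_diff) auto
qed simp

lemma crosses_measurable:
  assumes sp: "space K = space M" and "0 \<le> \<delta>"
    and T: "\<And>l. l \<le> Suc n \<Longrightarrow> T l \<in> borel_measurable K"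
    and J: "\<And>l. l \<le> n \<Longrightarrow> J l \<in> measurable K (count_space UNIV)"
  shows "Measurable.pred (paths \<Otimes>\<^sub>M K) (\<lambda>z. crosses \<delta> v n k (fst z) (snd z))"
proof -
  have [measurable]: "T n \<in> borel_measurable K" "T (Suc n) \<in> borel_measurable K" using T by auto
  have [measurable]: "(\<lambda>z. position n (real k * \<delta>) (fst z) (snd z)) \<in> borel_measurable (paths \<Otimes>\<^sub>M K)"
    using assms by (intro position_measurable start_measurable) auto
  show ?thesis unfolding crosses_def by measurable
qed

lemma clear_measurable:
  assumes sp: "space K = space M" and "0 \<le> \<delta>"
    and T: "\<And>l. l \<le> n \<Longrightarrow> T l \<in> borel_measurable K"
    and J: "\<And>l. l < n \<Longrightarrow> J l \<in> measurable K (count_space UNIV)"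
  shows "Measurable.pred (paths \<Otimes>\<^sub>M K) (\<lambda>z. clear \<delta> v n (fst z) (snd z))"
proof -
  have "Measurable.pred (paths \<Otimes>\<^sub>M K) (\<lambda>z. l < n \<longrightarrow> (\<forall>k. \<not> crosses \<delta> v l k (fst z) (snd z)))" for l
  proof (cases "l < n")
    case True
    then have [measurable]: "Measurable.pred (paths \<Otimes>\<^sub>M K) (\<lambda>z. crosses \<delta> v l k (fst z) (snd z))" for k
      using assms by (intro crosses_measurable) auto
    show ?thesis by measurable
  qed simp
  then show ?thesis unfolding clear_def by (rule pred_intros_countable(1))
qed

text \<open>
  For fixed epochs and regimes, everything that happens before time \<open>a\<close> is a functional of the
  paths up to \<open>a\<close>. These facts supply the adaptedness required for splitting off the increment
  after \<open>a\<close>.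
\<close>

lemma start_past:
  assumes w2: "w2 \<in> space M" and "T n w2 \<le> a"
  shows "(\<lambda>w1. start n w1 w2) \<in> borel_measurable (paths_upto a)"
  using assms(2)
proof (induction n)
  case (Suc n)
  have le: "T n w2 \<le> a" using Suc.prems epoch_Suc_less[OF w2, of n] by simp
  have "X (J n w2) (T l w2) \<in> borel_measurable (paths_upto a)" if "l \<le> Suc n" for l
    using regime_range[OF w2] epoch_nonneg[OF w2] epoch_mono[OF w2 that] Suc.prems
    by (intro path_measurable_paths(2)) auto
  then show ?case
    unfolding start_Suc position_def using Suc.IH[OF le]
    by (intro borel_measurable_add borel_measurable_diff) auto
qed simp

lemma position_past:
  assumes w2: "w2 \<in> space M" and s: "0 \<le> s" "T n w2 + s \<le> a"
  shows "(\<lambda>w1. position n s w1 w2) \<in> borel_measurable (paths_upto a)"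
  unfolding position_def
  using start_past[OF w2, of n a] s path_measurable_paths(2)[of "J n w2" _ a]
    regime_range[OF w2] epoch_nonneg[OF w2, of n]
  by (intro borel_measurable_add borel_measurable_diff) auto

lemma crosses_past:
  assumes w2: "w2 \<in> space M" and "0 \<le> \<delta>" "T (Suc n) w2 \<le> a"
  shows "Measurable.pred (paths_upto a) (\<lambda>w1. crosses \<delta> v n k w1 w2)"
proof (cases "real k * \<delta> < T (Suc n) w2 - T n w2")
  case True
  then have [measurable]: "(\<lambda>w1. position n (real k * \<delta>) w1 w2) \<in> borel_measurable (paths_upto a)"
    using assms by (intro position_past) auto
  show ?thesis unfolding crosses_def by measurable
qed (simp add: crosses_def)

lemma clear_past:
  assumes w2: "w2 \<in> space M" and "0 \<le> \<delta>" "T n w2 \<le> a"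
  shows "Measurable.pred (paths_upto a) (\<lambda>w1. clear \<delta> v n w1 w2)"
proof -
  have "Measurable.pred (paths_upto a) (\<lambda>w1. l < n \<longrightarrow> (\<forall>k. \<not> crosses \<delta> v l k w1 w2))" for l
  proof (cases "l < n")
    case True
    then have "T (Suc l) w2 \<le> a" using epoch_mono[OF w2, of "Suc l" n] assms(3) by simp
    then have [measurable]: "Measurable.pred (paths_upto a) (\<lambda>w1. crosses \<delta> v l k w1 w2)" for k
      using assms by (intro crosses_past) auto
    show ?thesis by measurable
  qed simp
  then show ?thesis unfolding clear_def by (rule pred_intros_countable(1))
qed

section \<open>Exponential moments over one cycle\<close>

lemma increment_exp_moment:
  assumes i: "i \<in> {1..d}" and ab: "0 \<le> a" "a \<le> b"
    and f: "f \<in> borel_measurable (paths_upto a)"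
  shows "(\<integral>\<^sup>+w. f w * ennreal (exp (\<omega> * (X i b w - X i a w))) \<partial>M) =
    (\<integral>\<^sup>+w. f w \<partial>M) * ennreal (exp ((b - a) * tilt i))"
proof -
  let ?F = "generated_algebra M borel UNIV (\<lambda>_::unit. \<lambda>w. X i b w - X i a w)"
  have [measurable]: "X i a \<in> borel_measurable M" "X i b \<in> borel_measurable M" "X i (b - a) \<in> borel_measurable M"
    using path_measurable[OF i] ab by auto
  have [measurable]: "(\<lambda>w. X i b w - X i a w) \<in> borel_measurable ?F"
    by (intro measurable_generated_algebra) auto
  have "(\<integral>\<^sup>+w. f w * ennreal (exp (\<omega> * (X i b w - X i a w))) \<partial>M) =
    (\<integral>\<^sup>+w. f w \<partial>M) * (\<integral>\<^sup>+w. ennreal (exp (\<omega> * (X i b w - X i a w))) \<partial>M)"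
  proof (rule nn_integral_indep_mult[OF subalgebra_paths(2) _ _ f])
    show "subalgebra M ?F" by (intro subalgebra_generated_algebra) auto
    show "indep_set (sets (paths_upto a)) (sets ?F)" using indep_past_increment[OF i ab] by simp
  qed measurable
  also have "(\<integral>\<^sup>+w. ennreal (exp (\<omega> * (X i b w - X i a w))) \<partial>M) =
      (\<integral>\<^sup>+x. ennreal (exp (\<omega> * x)) \<partial>distr M borel (\<lambda>w. X i (a + (b - a)) w - X i a w))"
    by (subst nn_integral_distr) auto
  also have "distr M borel (\<lambda>w. X i (a + (b - a)) w - X i a w) = distr M borel (X i (b - a))"
  proof -
    have "\<forall>s\<ge>0. \<forall>h\<ge>0. distr M borel (\<lambda>w. X i (s + h) w - X i s w) = distr M borel (X i h)"
      using levy[OF i] unfolding levy_process_def by blast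
    from this[rule_format, of a "b - a"] show ?thesis using ab by simp
  qed
  also have "(\<integral>\<^sup>+x. ennreal (exp (\<omega> * x)) \<partial>distr M borel (X i (b - a))) =
      ennreal (exp ((b - a) * tilt i))"
    using levy_process_exp_moment[OF levy[OF i] tilt_finite[OF i], of "b - a"] ab
    by (subst nn_integral_distr) (auto simp: tilt_def)
  finally show ?thesis .
qed

text \<open>
  Conditioning on the past epochs and all regimes: the length of cycle \<open>n\<close> may be integrated
  out separately.
\<close>

lemma cycle_length_integral:
  assumes G: "G \<in> borel_measurable (regime_clock_upto n)"
    and g: "(\<lambda>z. g (J n (snd z)) (T (Suc n) (fst z) - T n (fst z))) \<in> borel_measurable
      (generated_algebra M borel UNIV (\<lambda>_::unit. \<lambda>w. T (Suc n) w - T n w) \<Otimes>\<^sub>M regime_clock_upto n)"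
  shows "(\<integral>\<^sup>+w. G w * g (J n w) (T (Suc n) w - T n w) \<partial>M) =
    (\<integral>\<^sup>+w2. G w2 * (\<integral>\<^sup>+w1. g (J n w2) (T (Suc n) w1 - T n w1) \<partial>M) \<partial>M)"
proof -
  let ?F = "generated_algebra M borel UNIV (\<lambda>_::unit. \<lambda>w. T (Suc n) w - T n w)"
  note G[measurable] g[measurable]
  have sub: "subalgebra M ?F" "subalgebra M (regime_clock_upto n)"
    using epoch_measurable by (auto intro!: subalgebra_generated_algebra subalgebra_environment)
  have ind: "indep_set (sets ?F) (sets (regime_clock_upto n))"
    using indep_set_sym[OF indep_past_cycle_length[of n]] by simp
  let ?f = "\<lambda>z. G (snd z) * g (J n (snd z)) (T (Suc n) (fst z) - T n (fst z))"
  have f: "?f \<in> borel_measurable (?F \<Otimes>\<^sub>M regime_clock_upto n)" by measurable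
  have "(\<integral>\<^sup>+w. G w * g (J n w) (T (Suc n) w - T n w) \<partial>M) =
    (\<integral>\<^sup>+w2. \<integral>\<^sup>+w1. G w2 * g (J n w2) (T (Suc n) w1 - T n w1) \<partial>M \<partial>M)"
    using nn_integral_diagonal(1)[OF sub ind f] by simp
  also have "\<dots> = (\<integral>\<^sup>+w2. G w2 * (\<integral>\<^sup>+w1. g (J n w2) (T (Suc n) w1 - T n w1) \<partial>M) \<partial>M)"
  proof (intro nn_integral_cong nn_integral_cmult)
    fix w2 assume w2: "w2 \<in> space M"
    have "(\<lambda>w1. g (J n w2) (T (Suc n) w1 - T n w1)) \<in> borel_measurable ?F"
      using nn_integral_diagonal(3)[OF sub ind g w2] by simp
    then show "(\<lambda>w1. g (J n w2) (T (Suc n) w1 - T n w1)) \<in> borel_measurable M"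
      using sub(1) by (rule measurable_from_subalg[rotated])
  qed
  finally show ?thesis .
qed

lemma tilt_measurable [measurable]:
  "J k \<in> measurable K (count_space UNIV) \<Longrightarrow> (\<lambda>w. tilt (J k w)) \<in> borel_measurable K"
  "J k \<in> measurable K (count_space UNIV) \<Longrightarrow> (\<lambda>w. cycle_moment (J k w)) \<in> borel_measurable K"
  by (erule measurable_compose, simp)+

lemma environment_refines:
  "subalgebra environment (regime_clock_upto n)" "subalgebra environment (clock_regime_before n)"
proof -
  have "sets regime \<union> sets (clock_upto n) \<subseteq> sets regime \<union> sets clock"
    using generated_events_mono[of "{..n}" UNIV M borel T] by (auto simp: clock_def clock_upto_def)
  then show "subalgebra environment (regime_clock_upto n)"
    by (simp add: subalgebra_def sets_join_algebra sigma_sets_mono')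
  have "sets clock \<union> sets (regime_before n) \<subseteq> sets regime \<union> sets clock"
    using generated_events_mono[of "{..<n}" UNIV M "count_space UNIV" J]
    by (auto simp: regime_def regime_before_def)
  then show "subalgebra environment (clock_regime_before n)"
    by (simp add: subalgebra_def sets_join_algebra sigma_sets_mono')
qed

text \<open>
  The martingale property of \<open>W\<close> within one cycle. The weight \<open>F\<close> depends on what is known at
  time \<open>s\<close> into cycle \<open>n\<close>: on regimes, epochs up to \<open>n\<close>, and paths up to the current time. For fixed
  epochs and regimes the remaining increment of the path contributes \<open>exp ((S - s) \<phi>)\<close>, where
  \<open>S\<close> is the cycle length. Integrating out \<open>S\<close>, lack of memory replaces this by the full cycle
  moment.
\<close>

lemma exp_increment_to_next_epoch:
  fixes F :: "'w \<times> 'w \<Rightarrow> ennreal"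
  assumes s: "0 \<le> s" and F: "F \<in> borel_measurable (paths \<Otimes>\<^sub>M regime_clock_upto n)"
    and past: "\<And>w2. w2 \<in> space M \<Longrightarrow> (\<lambda>w1. F (w1, w2)) \<in> borel_measurable (paths_upto (T n w2 + s))"
  shows "(\<integral>\<^sup>+w. F (w, w) * (if s < T (Suc n) w - T n w then
        ennreal (exp (\<omega> * (X (J n w) (T (Suc n) w) w - X (J n w) (T n w + s) w))) else 0) \<partial>M) =
    (\<integral>\<^sup>+w. F (w, w) * (if s < T (Suc n) w - T n w then ennreal (cycle_moment (J n w)) else 0) \<partial>M)"
    (is "?L = ?R")
proof -
  define G where "G w2 = (\<integral>\<^sup>+w1. F (w1, w2) \<partial>M)" for w2
  let ?S = "\<lambda>w. T (Suc n) w - T n w"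
  let ?K = "regime_clock_upto n"
  note sub = subalgebra_paths(1) subalgebra_environment(1)
  note diag = nn_integral_diagonal[OF sub indep_paths_environment]
  have [measurable]: "T (Suc n) \<in> borel_measurable environment" "T n \<in> borel_measurable environment"
    "J n \<in> measurable environment (count_space UNIV)" "J n \<in> measurable ?K (count_space UNIV)"
    by (intro measurable_environment)+
  have KE: "subalgebra environment ?K" by (rule environment_refines)
  have [measurable]: "F \<in> borel_measurable (paths \<Otimes>\<^sub>M environment)"
    by (rule measurable_pair_subalgebra[OF KE F])
  have indK: "indep_set (sets paths) (sets ?K)"
    using indep_paths_environment KE by (auto elim: indep_set_mono simp: subalgebra_def)
  have G: "G \<in> borel_measurable ?K"
    unfolding G_def
    by (rule nn_integral_diagonal(2)[OF subalgebra_paths(1) subalgebra_environment(2) indK F])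
  have [measurable]: "(\<lambda>z. X (J n (snd z)) (T (Suc n) (snd z)) (fst z)) \<in> borel_measurable (paths \<Otimes>\<^sub>M environment)"
    "(\<lambda>z. X (J n (snd z)) (T n (snd z) + s) (fst z)) \<in> borel_measurable (paths \<Otimes>\<^sub>M environment)"
    using s regime_range epoch_nonneg by (auto intro!: path_at_random_time_measurable)
  let ?Z = "\<lambda>z. if s < ?S (snd z) then
    ennreal (exp (\<omega> * (X (J n (snd z)) (T (Suc n) (snd z)) (fst z) - X (J n (snd z)) (T n (snd z) + s) (fst z)))) else 0"
  let ?m = "\<lambda>i x. if s < x then ennreal (exp ((x - s) * tilt i)) else 0"
  let ?c = "\<lambda>i x. if s < x then ennreal (cycle_moment i) else 0"
  have "?L = (\<integral>\<^sup>+w2. \<integral>\<^sup>+w1. F (w1, w2) * ?Z (w1, w2) \<partial>M \<partial>M)"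
  proof -
    have "(\<lambda>z. F z * ?Z z) \<in> borel_measurable (paths \<Otimes>\<^sub>M environment)" by measurable
    from diag(1)[OF this] show ?thesis by (simp only: fst_conv snd_conv)
  qed
  also have "\<dots> = (\<integral>\<^sup>+w2. G w2 * ?m (J n w2) (?S w2) \<partial>M)"
  proof (rule nn_integral_cong)
    fix w2 assume w2: "w2 \<in> space M"
    show "(\<integral>\<^sup>+w1. F (w1, w2) * ?Z (w1, w2) \<partial>M) = G w2 * ?m (J n w2) (?S w2)"
    proof (cases "s < ?S w2")
      case True
      then show ?thesis
        using increment_exp_moment[OF regime_range[OF w2, of n], of "T n w2 + s" "T (Suc n) w2", OF _ _ past[OF w2]]
          s epoch_nonneg[OF w2, of n]
        by (simp add: G_def algebra_simps)
    qed simp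
  qed
  also have "\<dots> = (\<integral>\<^sup>+w2. G w2 * (\<integral>\<^sup>+w1. ?m (J n w2) (?S w1) \<partial>M) \<partial>M)"
  proof (rule cycle_length_integral[OF G])
    have [measurable]: "?S \<in> borel_measurable (generated_algebra M borel UNIV (\<lambda>_::unit. ?S))"
      by (intro measurable_generated_algebra) auto
    show "(\<lambda>z. ?m (J n (snd z)) (?S (fst z))) \<in> borel_measurable
        (generated_algebra M borel UNIV (\<lambda>_::unit. ?S) \<Otimes>\<^sub>M ?K)"
      by measurable
  qed
  also have "\<dots> = (\<integral>\<^sup>+w2. G w2 * (\<integral>\<^sup>+w1. ?c (J n w2) (?S w1) \<partial>M) \<partial>M)"
  proof (rule nn_integral_cong)
    fix w2 assume w2: "w2 \<in> space M"
    let ?i = "J n w2"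
    have tilted: "(\<integral>\<^sup>+w1. ?m ?i (?S w1) \<partial>M) = ennreal (cycle_moment ?i) * ennreal (exp (- s * q))"
      unfolding cycle_moment_def using q_pos tilt_below_rate[OF regime_range[OF w2]] s
      by (intro exponential_residual_exp_moment[OF cycle_length_distributed]) (auto simp: tilt_def)
    \<comment> \<open>The survival probability is the same formula with exponent \<open>0\<close>.\<close>
    have survival: "ennreal (exp (- s * q)) = (\<integral>\<^sup>+w1. (if s < ?S w1 then 1 else 0) \<partial>M)"
      using q_pos s exponential_residual_exp_moment[OF cycle_length_distributed, of 0 s n] by (simp cong: if_cong)
    have "ennreal (cycle_moment ?i) * (\<integral>\<^sup>+w1. (if s < ?S w1 then 1 else 0) \<partial>M) = (\<integral>\<^sup>+w1. ennreal (cycle_moment ?i) * (if s < ?S w1 then 1 else 0) \<partial>M)"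
    proof (intro nn_integral_cmult[symmetric])
      have "?S \<in> borel_measurable M" by (intro borel_measurable_diff epoch_measurable)
      moreover have "(\<lambda>x. if s < x then 1 else 0 :: ennreal) \<in> borel_measurable borel" by measurable
      ultimately show "(\<lambda>w1. if s < ?S w1 then 1 else 0 :: ennreal) \<in> borel_measurable M"
        by (rule measurable_compose)
    qed
    also have "\<dots> = (\<integral>\<^sup>+w1. ?c ?i (?S w1) \<partial>M)" by (intro nn_integral_cong) simp
    finally have total: "ennreal (cycle_moment ?i) * (\<integral>\<^sup>+w1. (if s < ?S w1 then 1 else 0) \<partial>M) =
      (\<integral>\<^sup>+w1. ?c ?i (?S w1) \<partial>M)" .
    show "G w2 * (\<integral>\<^sup>+w1. ?m ?i (?S w1) \<partial>M) = G w2 * (\<integral>\<^sup>+w1. ?c ?i (?S w1) \<partial>M)"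
      by (simp only: tilted survival total)
  qed
  also have "\<dots> = (\<integral>\<^sup>+w2. G w2 * ?c (J n w2) (?S w2) \<partial>M)"
  proof (rule cycle_length_integral[OF G, symmetric])
    have [measurable]: "?S \<in> borel_measurable (generated_algebra M borel UNIV (\<lambda>_::unit. ?S))"
      by (intro measurable_generated_algebra) auto
    show "(\<lambda>z. ?c (J n (snd z)) (?S (fst z))) \<in> borel_measurable
        (generated_algebra M borel UNIV (\<lambda>_::unit. ?S) \<Otimes>\<^sub>M ?K)"
      by measurable
  qed
  also have "\<dots> = (\<integral>\<^sup>+w2. \<integral>\<^sup>+w1. F (w1, w2) * ?c (J n w2) (?S w2) \<partial>M \<partial>M)"
  proof (intro nn_integral_cong)
    fix w2 assume w2: "w2 \<in> space M"
    show "G w2 * ?c (J n w2) (?S w2) = (\<integral>\<^sup>+w1. F (w1, w2) * ?c (J n w2) (?S w2) \<partial>M)"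
      unfolding G_def using measurable_from_subalg[OF subalgebra_paths(2) past[OF w2]]
      by (intro nn_integral_multc[symmetric])
  qed
  also have "\<dots> = ?R"
  proof -
    have "(\<lambda>z. F z * ?c (J n (snd z)) (?S (snd z))) \<in> borel_measurable (paths \<Otimes>\<^sub>M environment)"
      by measurable
    from diag(1)[OF this] show ?thesis by (simp only: fst_conv snd_conv)
  qed
  finally show ?thesis .
qed

lemma mean_cycle_moment:
  "(\<integral>\<^sup>+w. ennreal (cycle_moment (J n w)) \<partial>M) = ennreal (\<Sum>i=1..d. cycle_moment i * p i)"
proof -
  note regime_measurable[of n, measurable]
  let ?A = "\<lambda>i. {w \<in> space M. J n w = i}"
  have pos: "0 \<le> cycle_moment i" if "i \<in> {1..d}" for i using cycle_moment_pos[OF that] by simp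
  have p_nonneg: "0 \<le> p i" if "i \<in> {1..d}" for i
    using regime_law[OF that, of n] measure_nonneg[of M] by metis
  have "(\<integral>\<^sup>+w. ennreal (cycle_moment (J n w)) \<partial>M) =
    (\<integral>\<^sup>+w. (\<Sum>i=1..d. ennreal (cycle_moment i) * indicator (?A i) w) \<partial>M)"
  proof (rule nn_integral_cong)
    fix w assume w: "w \<in> space M"
    have "(\<Sum>i=1..d. ennreal (cycle_moment i) * indicator (?A i) w) =
        (\<Sum>i=1..d. if J n w = i then ennreal (cycle_moment i) else 0)"
      using w by (intro sum.cong) (auto simp: indicator_def)
    also have "\<dots> = ennreal (cycle_moment (J n w))"
      using regime_range[OF w] by simp
    finally show "ennreal (cycle_moment (J n w)) = (\<Sum>i=1..d. ennreal (cycle_moment i) * indicator (?A i) w)" ..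
  qed
  also have "\<dots> = (\<Sum>i=1..d. ennreal (cycle_moment i) * emeasure M (?A i))"
    by (subst nn_integral_sum) (auto simp: nn_integral_cmult_indicator)
  also have "\<dots> = (\<Sum>i=1..d. ennreal (cycle_moment i * p i))"
  proof (intro sum.cong refl)
    fix i assume i: "i \<in> {1..d}"
    show "ennreal (cycle_moment i) * emeasure M (?A i) = ennreal (cycle_moment i * p i)"
      by (simp add: emeasure_eq_measure regime_law[OF i] ennreal_mult[OF pos[OF i] p_nonneg[OF i]])
  qed
  also have "\<dots> = ennreal (\<Sum>i=1..d. cycle_moment i * p i)"
    using pos p_nonneg by (intro sum_ennreal mult_nonneg_nonneg) auto
  finally show ?thesis .
qed

text \<open>
  The regime drawn at epoch \<open>n\<close> is independent of paths, clock and earlier regimes.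
\<close>

lemma regime_average:
  fixes F :: "'w \<times> 'w \<Rightarrow> ennreal"
  assumes F: "F \<in> borel_measurable (paths \<Otimes>\<^sub>M clock_regime_before n)"
  shows "(\<integral>\<^sup>+w. F (w, w) * ennreal (cycle_moment (J n w)) \<partial>M) =
    (\<integral>\<^sup>+w. F (w, w) \<partial>M) * (\<integral>\<^sup>+w. ennreal (cycle_moment (J n w)) \<partial>M)"
proof -
  let ?K = "clock_regime_before n"
  let ?N = "generated_algebra M (count_space UNIV) {n} J"
  define G where "G w2 = (\<integral>\<^sup>+w1. F (w1, w2) \<partial>M)" for w2
  have KE: "subalgebra environment ?K" by (rule environment_refines)
  have FE: "F \<in> borel_measurable (paths \<Otimes>\<^sub>M environment)"
    by (rule measurable_pair_subalgebra[OF KE F])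
  have indK: "indep_set (sets paths) (sets ?K)"
    using indep_paths_environment KE by (auto elim: indep_set_mono simp: subalgebra_def)
  note diagK = nn_integral_diagonal[OF subalgebra_paths(1) subalgebra_environment(3) indK F]
  have G: "G \<in> borel_measurable ?K"
    unfolding G_def by (rule diagK(2))
  have JE: "(\<lambda>w. ennreal (cycle_moment (J n w))) \<in> borel_measurable environment"
    using measurable_environment(2)[of n] by measurable
  have "(\<lambda>z. F z * ennreal (cycle_moment (J n (snd z)))) \<in> borel_measurable (paths \<Otimes>\<^sub>M environment)"
    using FE measurable_compose[OF measurable_snd JE] by (rule borel_measurable_times_ennreal)
  from nn_integral_diagonal(1)[OF subalgebra_paths(1) subalgebra_environment(1) indep_paths_environment this]
  have "(\<integral>\<^sup>+w. F (w, w) * ennreal (cycle_moment (J n w)) \<partial>M) =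
    (\<integral>\<^sup>+w2. \<integral>\<^sup>+w1. F (w1, w2) * ennreal (cycle_moment (J n w2)) \<partial>M \<partial>M)" by simp
  also have "\<dots> = (\<integral>\<^sup>+w2. G w2 * ennreal (cycle_moment (J n w2)) \<partial>M)"
    unfolding G_def using measurable_from_subalg[OF subalgebra_paths(1) diagK(3)]
    by (intro nn_integral_cong nn_integral_multc)
  also have "\<dots> = (\<integral>\<^sup>+w2. G w2 \<partial>M) * (\<integral>\<^sup>+w2. ennreal (cycle_moment (J n w2)) \<partial>M)"
  proof (rule nn_integral_indep_mult[OF subalgebra_environment(3) _ _ G])
    show "subalgebra M ?N" using regime_measurable by (intro subalgebra_generated_algebra)
    show "indep_set (sets ?K) (sets ?N)" using indep_past_regime by simp
    have "J n \<in> measurable ?N (count_space UNIV)" by (intro measurable_generated_algebra) auto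
    then show "(\<lambda>w2. ennreal (cycle_moment (J n w2))) \<in> borel_measurable ?N" by measurable
  qed
  also have "(\<integral>\<^sup>+w2. G w2 \<partial>M) = (\<integral>\<^sup>+w. F (w, w) \<partial>M)"
    unfolding G_def by (rule diagK(1)[symmetric])
  finally show ?thesis .
qed

lemma position_increment:
  "start (Suc n) w1 w2 = position n s w1 w2 +
    (X (J n w2) (T (Suc n) w2) w1 - X (J n w2) (T n w2 + s) w1)"
  by (simp add: start_Suc position_def)

lemma position_0 [simp]: "position n 0 w1 w2 = start n w1 w2"
  by (simp add: position_def)

text \<open>
  A complete cycle multiplies the exponential mass of the paths without crossing by the mean
  cycle moment;
  this is the one-cycle identity with \<open>s = 0\<close>, averaged over the fresh regime.
\<close>

lemma exp_start_Suc:
  assumes \<delta>: "0 \<le> \<delta>"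
  shows "(\<integral>\<^sup>+w. (if clear \<delta> v n w w then ennreal (exp (\<omega> * start (Suc n) w w)) else 0) \<partial>M) =
    (\<integral>\<^sup>+w. (if clear \<delta> v n w w then ennreal (exp (\<omega> * start n w w)) else 0) \<partial>M) *
    (\<integral>\<^sup>+w. ennreal (cycle_moment (J n w)) \<partial>M)"
proof -
  define F where "F z = (if clear \<delta> v n (fst z) (snd z) then ennreal (exp (\<omega> * start n (fst z) (snd z))) else 0)" for z
  have F: "F \<in> borel_measurable (paths \<Otimes>\<^sub>M K)"
    if "space K = space M" "\<And>l. l \<le> n \<Longrightarrow> T l \<in> borel_measurable K"
      "\<And>l. l < n \<Longrightarrow> J l \<in> measurable K (count_space UNIV)" for K
  proof -
    have [measurable]: "Measurable.pred (paths \<Otimes>\<^sub>M K) (\<lambda>z. clear \<delta> v n (fst z) (snd z))"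
      "(\<lambda>z. start n (fst z) (snd z)) \<in> borel_measurable (paths \<Otimes>\<^sub>M K)"
      using that \<delta> by (auto intro!: clear_measurable start_measurable)
    show ?thesis unfolding F_def by measurable
  qed
  have past: "(\<lambda>w1. F (w1, w2)) \<in> borel_measurable (paths_upto (T n w2 + 0))" if w2: "w2 \<in> space M" for w2
  proof -
    have [measurable]: "Measurable.pred (paths_upto (T n w2 + 0)) (\<lambda>w1. clear \<delta> v n w1 w2)"
      "(\<lambda>w1. start n w1 w2) \<in> borel_measurable (paths_upto (T n w2 + 0))"
      using \<delta> by (auto intro!: clear_past start_past w2)
    show ?thesis unfolding F_def fst_conv snd_conv by measurable
  qed
  have "(\<integral>\<^sup>+w. (if clear \<delta> v n w w then ennreal (exp (\<omega> * start (Suc n) w w)) else 0) \<partial>M) =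
    (\<integral>\<^sup>+w. F (w, w) * (if 0 < T (Suc n) w - T n w then
        ennreal (exp (\<omega> * (X (J n w) (T (Suc n) w) w - X (J n w) (T n w + 0) w))) else 0) \<partial>M)"
  proof (rule nn_integral_cong)
    fix w assume w: "w \<in> space M"
    have "\<omega> * start (Suc n) w w =
        \<omega> * start n w w + \<omega> * (X (J n w) (T (Suc n) w) w - X (J n w) (T n w + 0) w)"
      using position_increment[of n w w 0] by (simp only: distrib_left position_0)
    then show "(if clear \<delta> v n w w then ennreal (exp (\<omega> * start (Suc n) w w)) else 0) =
      F (w, w) * (if 0 < T (Suc n) w - T n w then
        ennreal (exp (\<omega> * (X (J n w) (T (Suc n) w) w - X (J n w) (T n w + 0) w))) else 0)"
      using epoch_Suc_less[OF w, of n] by (simp add: F_def exp_add ennreal_mult')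
  qed
  also have "\<dots> = (\<integral>\<^sup>+w. F (w, w) * (if 0 < T (Suc n) w - T n w then ennreal (cycle_moment (J n w)) else 0) \<partial>M)"
    by (rule exp_increment_to_next_epoch[OF _ F past]) (simp_all add: measurable_environment)
  also have "\<dots> = (\<integral>\<^sup>+w. F (w, w) * ennreal (cycle_moment (J n w)) \<partial>M)"
    using epoch_Suc_less by (intro nn_integral_cong) simp
  also have "\<dots> = (\<integral>\<^sup>+w. F (w, w) \<partial>M) * (\<integral>\<^sup>+w. ennreal (cycle_moment (J n w)) \<partial>M)"
    by (intro regime_average F) (simp_all add: measurable_environment)
  finally show ?thesis by (simp only: F_def fst_conv snd_conv)
qed

section \<open>First crossings on a grid and the maximal inequality\<close>

definition first_crossing :: "real \<Rightarrow> real \<Rightarrow> nat \<Rightarrow> nat \<Rightarrow> 'w set" where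
  "first_crossing \<delta> v n k = {w \<in> space M. clear \<delta> v n w w \<and>
     (\<forall>j<k. \<not> crosses \<delta> v n j w w) \<and> crosses \<delta> v n k w w}"

lemma diagonal_measurable: "(\<lambda>w. (w, w)) \<in> measurable M (paths \<Otimes>\<^sub>M environment)"
  by (rule measurable_Pair[OF measurable_from_subalg[OF subalgebra_paths(1) measurable_ident_sets[OF refl]]
        measurable_from_subalg[OF subalgebra_environment(1) measurable_ident_sets[OF refl]]])

lemma diagonal_events [measurable]:
  assumes "0 \<le> \<delta>"
  shows "Measurable.pred M (\<lambda>w. crosses \<delta> v n k w w)" "Measurable.pred M (\<lambda>w. clear \<delta> v n w w)"
    and "(\<lambda>w. start n w w) \<in> borel_measurable M"
  using measurable_compose[OF diagonal_measurable crosses_measurable[of environment \<delta>]]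
    measurable_compose[OF diagonal_measurable clear_measurable[of environment \<delta>]]
    measurable_compose[OF diagonal_measurable start_measurable[of environment]] assms
  by (simp_all add: measurable_environment)

lemma first_crossing_events: "0 \<le> \<delta> \<Longrightarrow> first_crossing \<delta> v n k \<in> sets M"
  unfolding first_crossing_def by measurable

text \<open>
  A first crossing at grid point \<open>k\<close> is decided by the past at that moment, apart from the
  survival of the cycle. There \<open>exp (\<omega> X)\<close> is at least \<open>exp (\<omega> v)\<close>, and until the end of
  the cycle it is multiplied in mean by a cycle moment, which is at least \<open>\<kappa>\<close>.
\<close>

lemma first_crossing_bound:
  assumes \<delta>: "0 < \<delta>" and \<omega>: "0 \<le> \<omega>"
    and \<kappa>: "0 \<le> \<kappa>" "\<And>i. i \<in> {1..d} \<Longrightarrow> \<kappa> \<le> cycle_moment i"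
  shows "(\<integral>\<^sup>+w. ennreal (\<kappa> * exp (\<omega> * v)) * indicator (first_crossing \<delta> v n k) w \<partial>M) \<le>
    (\<integral>\<^sup>+w. ennreal (exp (\<omega> * start (Suc n) w w)) * indicator (first_crossing \<delta> v n k) w \<partial>M)"
proof -
  let ?s = "real k * \<delta>"
  have s: "0 \<le> ?s" using \<delta> by simp
  \<comment> \<open>If the cycle survives to grid point \<open>k\<close>, it survives to the earlier ones; survival is a separate factor.\<close>
  define A where "A z \<longleftrightarrow> clear \<delta> v n (fst z) (snd z) \<and>
    (\<forall>j<k. position n (real j * \<delta>) (fst z) (snd z) \<le> v) \<and> v < position n ?s (fst z) (snd z)" for z
  define F where "F z = (if A z then ennreal (exp (\<omega> * position n ?s (fst z) (snd z))) else 0)" for z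
  let ?K = "regime_clock_upto n"
  have F: "F \<in> borel_measurable (paths \<Otimes>\<^sub>M ?K)"
  proof -
    have [measurable]: "Measurable.pred (paths \<Otimes>\<^sub>M ?K) (\<lambda>z. clear \<delta> v n (fst z) (snd z))"
      "\<And>j. (\<lambda>z. position n (real j * \<delta>) (fst z) (snd z)) \<in> borel_measurable (paths \<Otimes>\<^sub>M ?K)"
      using \<delta> by (auto intro!: clear_measurable position_measurable start_measurable measurable_environment)
    show ?thesis unfolding F_def A_def by measurable
  qed
  have past: "(\<lambda>w1. F (w1, w2)) \<in> borel_measurable (paths_upto (T n w2 + ?s))" if w2: "w2 \<in> space M" for w2
  proof -
    have [measurable]: "Measurable.pred (paths_upto (T n w2 + ?s)) (\<lambda>w1. clear \<delta> v n w1 w2)"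
      using \<delta> by (auto intro!: clear_past w2)
    have pos[measurable]: "(\<lambda>w1. position n (real j * \<delta>) w1 w2) \<in> borel_measurable (paths_upto (T n w2 + ?s))" if "j \<le> k" for j
      using \<delta> that by (intro position_past w2) auto
    have [measurable]: "Measurable.pred (paths_upto (T n w2 + ?s)) (\<lambda>w1. \<forall>j<k. position n (real j * \<delta>) w1 w2 \<le> v)"
    proof (rule pred_intros_countable(1))
      show "Measurable.pred (paths_upto (T n w2 + ?s)) (\<lambda>w1. j < k \<longrightarrow> position n (real j * \<delta>) w1 w2 \<le> v)" for j
      proof (cases "j < k")
        case True
        then have [measurable]: "(\<lambda>w1. position n (real j * \<delta>) w1 w2) \<in> borel_measurable (paths_upto (T n w2 + ?s))"
          by (intro pos) simp
        show ?thesis by measurable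
      qed simp
    qed
    show ?thesis unfolding F_def A_def fst_conv snd_conv using pos[of k] by measurable
  qed
  have A: "w \<in> first_crossing \<delta> v n k \<longleftrightarrow> A (w, w) \<and> ?s < T (Suc n) w - T n w" if "w \<in> space M" for w
  proof -
    have earlier: "real j * \<delta> < T (Suc n) w - T n w" if "?s < T (Suc n) w - T n w" "j < k" for j
    proof -
      have "real j * \<delta> \<le> ?s" using that \<delta> by simp
      then show ?thesis using that by simp
    qed
    show ?thesis
    proof (cases "?s < T (Suc n) w - T n w")
      case True
      have "crosses \<delta> v n j w w \<longleftrightarrow> v < position n (real j * \<delta>) w w" if "j < k" for j
        using earlier[OF True that] by (simp add: crosses_def)
      moreover have "crosses \<delta> v n k w w \<longleftrightarrow> v < position n ?s w w"
        using True by (simp add: crosses_def)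
      ultimately show ?thesis
        using that True by (simp add: first_crossing_def A_def not_less cong: conj_cong)
    next
      case False
      then show ?thesis by (simp add: first_crossing_def crosses_def)
    qed
  qed
  have "(\<integral>\<^sup>+w. ennreal (\<kappa> * exp (\<omega> * v)) * indicator (first_crossing \<delta> v n k) w \<partial>M) \<le>
    (\<integral>\<^sup>+w. F (w, w) * (if ?s < T (Suc n) w - T n w then ennreal (cycle_moment (J n w)) else 0) \<partial>M)"
  proof (rule nn_integral_mono)
    fix w assume w: "w \<in> space M"
    have "\<kappa> * exp (\<omega> * v) \<le> cycle_moment (J n w) * exp (\<omega> * position n ?s w w)" if "A (w, w)"
      using that \<kappa>(2)[OF regime_range[OF w]] order_trans[OF \<kappa>(1) \<kappa>(2)[OF regime_range[OF w]]] \<omega>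
      by (intro mult_mono) (auto simp: A_def intro: mult_left_mono)
    then show "ennreal (\<kappa> * exp (\<omega> * v)) * indicator (first_crossing \<delta> v n k) w \<le>
      F (w, w) * (if ?s < T (Suc n) w - T n w then ennreal (cycle_moment (J n w)) else 0)"
      using A[OF w] by (auto simp: F_def indicator_def ennreal_mult''[symmetric] mult.commute intro!: ennreal_leI)
  qed
  also have "\<dots> = (\<integral>\<^sup>+w. F (w, w) * (if ?s < T (Suc n) w - T n w then
        ennreal (exp (\<omega> * (X (J n w) (T (Suc n) w) w - X (J n w) (T n w + ?s) w))) else 0) \<partial>M)"
    by (rule exp_increment_to_next_epoch[OF s F past, symmetric])
  also have "\<dots> = (\<integral>\<^sup>+w. ennreal (exp (\<omega> * start (Suc n) w w)) * indicator (first_crossing \<delta> v n k) w \<partial>M)"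
    using A
    by (intro nn_integral_cong)
       (auto simp: F_def indicator_def position_increment[where s="?s"] ennreal_mult'[symmetric]
         exp_add[symmetric] distrib_left)
  finally show ?thesis .
qed

text \<open>
  The events of a first crossing at the various grid points are disjoint, so their bounds add up.
\<close>

lemma crossing_in_cycle_bound:
  fixes n :: nat and v \<delta> \<kappa> :: real
  assumes \<delta>: "0 < \<delta>" and \<omega>: "0 \<le> \<omega>"
    and \<kappa>: "0 \<le> \<kappa>" "\<And>i. i \<in> {1..d} \<Longrightarrow> \<kappa> \<le> cycle_moment i"
  defines "H \<equiv> {w \<in> space M. clear \<delta> v n w w \<and> (\<exists>k. crosses \<delta> v n k w w)}"
  shows "ennreal (\<kappa> * exp (\<omega> * v)) * emeasure M H \<le>
    (\<integral>\<^sup>+w. ennreal (exp (\<omega> * start (Suc n) w w)) * indicator H w \<partial>M)"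
proof -
  let ?B = "first_crossing \<delta> v n"
  have B: "?B k \<in> sets M" for k using first_crossing_events \<delta> by simp
  have disj: "disjoint_family ?B"
    unfolding disjoint_family_on_def first_crossing_def by (auto, metis linorder_neqE_nat)
  have H: "H = (\<Union>k. ?B k)"
  proof -
    have "\<exists>k. (\<forall>j<k. \<not> crosses \<delta> v n j w w) \<and> crosses \<delta> v n k w w" if "crosses \<delta> v n k w w" for k w
      using exists_least_iff[of "\<lambda>k. crosses \<delta> v n k w w"] that by blast
    then show ?thesis unfolding H_def first_crossing_def by blast
  qed
  have [measurable]: "(\<lambda>w. start (Suc n) w w) \<in> borel_measurable M" by (rule diagonal_events(3)[of 0]) simp
  have "ennreal (\<kappa> * exp (\<omega> * v)) * emeasure M H = (\<integral>\<^sup>+w\<in>(\<Union>k. ?B k). ennreal (\<kappa> * exp (\<omega> * v)) \<partial>M)"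
    unfolding H using B by (subst nn_integral_cmult_indicator) auto
  also have "\<dots> = (\<Sum>k. \<integral>\<^sup>+w\<in>?B k. ennreal (\<kappa> * exp (\<omega> * v)) \<partial>M)"
    using B disj by (intro nn_integral_disjoint_family) auto
  also have "\<dots> \<le> (\<Sum>k. \<integral>\<^sup>+w\<in>?B k. ennreal (exp (\<omega> * start (Suc n) w w)) \<partial>M)"
    using first_crossing_bound[OF \<delta> \<omega> \<kappa>] by (intro suminf_le) auto
  also have "\<dots> = (\<integral>\<^sup>+w\<in>(\<Union>k. ?B k). ennreal (exp (\<omega> * start (Suc n) w w)) \<partial>M)"
    using B disj by (intro nn_integral_disjoint_family[symmetric]) auto
  finally show ?thesis unfolding H .
qed

text \<open>
  The maximal inequality. The exponential mass of the paths that have not crossed starts at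
  \<open>1\<close>. In each cycle it is preserved in mean and then loses the part carried by the crossing
  paths, which is at least \<open>\<kappa> exp (\<omega> v)\<close> times their probability.
\<close>

lemma crossing_probability_bound:
  assumes \<delta>: "0 < \<delta>" and \<omega>: "0 \<le> \<omega>"
    and \<kappa>: "0 \<le> \<kappa>" "\<And>i. i \<in> {1..d} \<Longrightarrow> \<kappa> \<le> cycle_moment i"
    and mean: "(\<Sum>i=1..d. cycle_moment i * p i) = 1"
  shows "(\<integral>\<^sup>+w. (if clear \<delta> v n w w then ennreal (exp (\<omega> * start n w w)) else 0) \<partial>M) +
    ennreal (\<kappa> * exp (\<omega> * v)) * emeasure M {w \<in> space M. \<not> clear \<delta> v n w w} \<le> 1"
proof (induction n)
  case 0
  have "{w \<in> space M. \<not> clear \<delta> v 0 w w} = {}" by (simp add: clear_def)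
  then show ?case by (simp add: clear_def emeasure_space_1)
next
  case (Suc n)
  let ?c = "ennreal (\<kappa> * exp (\<omega> * v))"
  let ?a = "\<lambda>n. \<integral>\<^sup>+w. (if clear \<delta> v n w w then ennreal (exp (\<omega> * start n w w)) else 0) \<partial>M"
  let ?U = "\<lambda>n. {w \<in> space M. \<not> clear \<delta> v n w w}"
  let ?H = "{w \<in> space M. clear \<delta> v n w w \<and> (\<exists>k. crosses \<delta> v n k w w)}"
  have clear_Suc: "clear \<delta> v (Suc n) w w \<longleftrightarrow> clear \<delta> v n w w \<and> (\<forall>k. \<not> crosses \<delta> v n k w w)" for w
    by (auto simp: clear_def less_Suc_eq)
  have [measurable]: "Measurable.pred M (\<lambda>w. crosses \<delta> v n k w w)" "Measurable.pred M (\<lambda>w. clear \<delta> v n w w)"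
    "Measurable.pred M (\<lambda>w. clear \<delta> v (Suc n) w w)" "(\<lambda>w. start (Suc n) w w) \<in> borel_measurable M" for k
    using \<delta> diagonal_events(1,2)[of \<delta>] diagonal_events(3)[of 0] by simp_all
  have "?a (Suc n) + ?c * emeasure M (?U (Suc n)) \<le>
      ?a (Suc n) + ?c * (emeasure M (?U n) + emeasure M ?H)"
  proof (intro add_left_mono mult_left_mono)
    have "?U (Suc n) = ?U n \<union> ?H" using clear_Suc by auto
    then show "emeasure M (?U (Suc n)) \<le> emeasure M (?U n) + emeasure M ?H"
      using emeasure_subadditive[of "?U n" M ?H] by simp
  qed simp
  also have "\<dots> \<le> ?a (Suc n) + (?c * emeasure M (?U n) +
      (\<integral>\<^sup>+w. ennreal (exp (\<omega> * start (Suc n) w w)) * indicator ?H w \<partial>M))"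
    unfolding distrib_left by (intro add_left_mono crossing_in_cycle_bound[OF \<delta> \<omega> \<kappa>])
  also have "\<dots> = (?a (Suc n) + (\<integral>\<^sup>+w. ennreal (exp (\<omega> * start (Suc n) w w)) * indicator ?H w \<partial>M)) +
      ?c * emeasure M (?U n)"
    by (simp add: ac_simps)
  also have "?a (Suc n) + (\<integral>\<^sup>+w. ennreal (exp (\<omega> * start (Suc n) w w)) * indicator ?H w \<partial>M) =
      (\<integral>\<^sup>+w. (if clear \<delta> v n w w then ennreal (exp (\<omega> * start (Suc n) w w)) else 0) \<partial>M)"
    by (subst nn_integral_add[symmetric])
       (auto intro!: nn_integral_cong simp: clear_Suc indicator_def)
  also have "\<dots> = ?a n"
    using \<delta> exp_start_Suc[of \<delta> v n] mean_cycle_moment[of n] mean by simp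
  finally show ?case using Suc.IH by (rule order_trans)
qed

section \<open>From the grid to continuous time\<close>

lemma epoch_count_eq:
  assumes w: "w \<in> space M" and t: "T n w \<le> t" "t < T (Suc n) w"
  shows "epoch_count T t w = n"
proof -
  have "{m. 1 \<le> m \<and> T m w \<le> t} = {1..n}"
  proof (intro set_eqI iffI)
    fix m assume m: "m \<in> {m. 1 \<le> m \<and> T m w \<le> t}"
    then have "m < Suc n"
      using t epoch_mono[OF w, of "Suc n" m] by (auto simp: not_le[symmetric])
    then show "m \<in> {1..n}" using m by simp
  next
    fix m assume "m \<in> {1..n}"
    then show "m \<in> {m. 1 \<le> m \<and> T m w \<le> t}" using t epoch_mono[OF w, of m n] by auto
  qed
  then show ?thesis by (simp add: epoch_count_def)
qed

text \<open>
  The cycle that contains \<open>t\<close> exists because the epochs diverge.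
\<close>

lemma epoch_cell:
  assumes w: "w \<in> space M" and t: "0 \<le> t"
  obtains n where "T n w \<le> t" "t < T (Suc n) w"
proof -
  have "filterlim (\<lambda>n. T n w) at_top sequentially"
    using epochs w by (simp add: poisson_epochs_def)
  then have "\<exists>n. t < T n w"
    unfolding filterlim_at_top_dense by (meson eventually_happens' sequentially_bot)
  then obtain n where n: "t < T n w" "\<And>m. m < n \<Longrightarrow> \<not> t < T m w"
    using exists_least_iff[of "\<lambda>n. t < T n w"] by blast
  then obtain m where "n = Suc m" using t epoch_zero[OF w] by (cases n) auto
  then show ?thesis using n that[of m] by (auto simp: not_less)
qed

lemma resampled_eq_position:
  assumes "w \<in> space M" "T n w \<le> t" "t < T (Suc n) w"
  shows "resampled X T J t w = position n (t - T n w) w w"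
  by (simp add: resampled_def Let_def epoch_count_eq[OF assms] position_def start_diagonal)

text \<open>
  By right-continuity a value above \<open>v\<close> persists for a while inside the cycle, so a fine
  enough grid sees it. The single index \<open>N\<close> serves both as resolution and as the number of
  cycles inspected.
\<close>

lemma exceedance_imp_crossing:
  assumes w: "w \<in> space M" and t: "0 \<le> t" and v: "v < resampled X T J t w"
  shows "\<exists>N. \<not> clear (1 / 2 ^ N) v N w w"
proof -
  obtain n where n: "T n w \<le> t" "t < T (Suc n) w" using epoch_cell[OF w t] .
  define x where "x = t - T n w"
  have x: "0 \<le> x" using n by (simp add: x_def)
  have "((\<lambda>s. X (J n w) s w) \<longlongrightarrow> X (J n w) t w) (at_right t)"
    using levy[OF regime_range[OF w]] w t by (auto simp: levy_process_def)
  then have "((\<lambda>s. position n (s - T n w) w w) \<longlongrightarrow> position n (t - T n w) w w) (at_right t)"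
    unfolding position_def by (auto intro!: tendsto_intros)
  then have "eventually (\<lambda>s. v < position n (s - T n w) w w) (at_right t)"
    using v unfolding resampled_eq_position[OF w n] by (rule order_tendstoD)
  then obtain b where b: "t < b" "\<And>s. t < s \<Longrightarrow> s < b \<Longrightarrow> v < position n (s - T n w) w w"
    unfolding eventually_at_right_field by blast
  define y where "y = min b (T (Suc n) w) - T n w"
  have "x < y" using b n by (simp add: x_def y_def)
  have "eventually (\<lambda>N. (real (nat \<lfloor>2 ^ N * x\<rfloor>) + 1) / 2 ^ N \<in> {x<..<y}) sequentially"
    using filterlim_grid_at_right[OF x, unfolded filterlim_iff, rule_format,
        OF eventually_at_right_real[OF \<open>x < y\<close>]] .
  then have "eventually (\<lambda>N. (real (nat \<lfloor>2 ^ N * x\<rfloor>) + 1) / 2 ^ N \<in> {x<..<y} \<and> n < N) sequentially"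
    using eventually_gt_at_top[of n] by (rule eventually_conj)
  then obtain N where N: "(real (nat \<lfloor>2 ^ N * x\<rfloor>) + 1) / 2 ^ N \<in> {x<..<y}" "n < N"
    using eventually_happens'[OF sequentially_bot] by blast
  define k where "k = nat \<lfloor>2 ^ N * x\<rfloor> + 1"
  have "real k * (1 / 2 ^ N) = (real (nat \<lfloor>2 ^ N * x\<rfloor>) + 1) / 2 ^ N" by (simp add: k_def)
  then have k: "x < real k * (1 / 2 ^ N)" "real k * (1 / 2 ^ N) < y"
    using N(1) by (simp_all only: greaterThanLessThan_iff)
  define s where "s = real k * (1 / 2 ^ N)"
  have s: "t < T n w + s" "T n w + s < b" "s < T (Suc n) w - T n w"
    using k unfolding s_def[symmetric] x_def y_def by linarith+
  have "v < position n s w w"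
    using b(2)[OF s(1,2)] by simp
  then have "crosses (1 / 2 ^ N) v n k w w"
    using s(3) by (simp only: crosses_def s_def)
  then show ?thesis using N(2) unfolding clear_def by blast
qed

text \<open>
  Crossing events increase with \<open>N\<close>, because the grid of resolution \<open>N\<close> is contained in the
  next finer one.
\<close>

lemma clear_refine:
  assumes "clear (1 / 2 ^ Suc N) v (Suc N) w1 w2"
  shows "clear (1 / 2 ^ N) v N w1 w2"
  unfolding clear_def
proof (intro allI impI notI)
  fix l k assume l: "l < N" "crosses (1 / 2 ^ N) v l k w1 w2"
  have "real (2 * k) * (1 / 2 ^ Suc N) = real k * (1 / 2 ^ N)" by simp
  then have "crosses (1 / 2 ^ Suc N) v l (2 * k) w1 w2"
    using l(2) unfolding crosses_def by (simp only:)
  then show False using assms l(1) unfolding clear_def by (meson less_SucI)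
qed

text \<open>
  The equation that defines \<open>\<omega>\<close>, rewritten by the one-cycle identity for the first cycle. A
  Bochner integral equal to \<open>1\<close> is never the default value \<open>0\<close>, so the integrand is integrable.
\<close>

lemma mean_cycle_moment_eq_1:
  assumes root: "(\<integral>w. exp (\<omega> * resampled X T J (T 1 w) w) \<partial>M) = 1"
  shows "(\<Sum>i=1..d. cycle_moment i * p i) = 1"
proof -
  have eq: "resampled X T J (T 1 w) w = start 1 w w" if w: "w \<in> space M" for w
    using resampled_eq_position[OF w order_refl epoch_Suc_less[OF w]] by simp
  then have "(\<integral>w. exp (\<omega> * start 1 w w) \<partial>M) = 1"
    using root by (simp cong: Bochner_Integration.integral_cong)
  moreover from this have "integrable M (\<lambda>w. exp (\<omega> * start 1 w w))"
    using not_integrable_integral_eq[of M "\<lambda>w. exp (\<omega> * start 1 w w)"] by (cases "integrable M (\<lambda>w. exp (\<omega> * start 1 w w))") auto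
  ultimately have "(\<integral>\<^sup>+w. ennreal (exp (\<omega> * start 1 w w)) \<partial>M) = 1"
    by (simp add: nn_integral_eq_integral)
  then have "ennreal (\<Sum>i=1..d. cycle_moment i * p i) = 1"
    using exp_start_Suc[of 0 0 0] mean_cycle_moment[of 0]
    by (simp add: clear_def emeasure_space_1)
  then show ?thesis by (metis ennreal_eq_1)
qed

text \<open>
  The maximal inequality is strict in the level, hence it is applied to all \<open>v < u\<close> first.
\<close>

theorem ruin_probability_bound:
  assumes \<omega>: "0 < \<omega>" and root: "(\<integral>w. exp (\<omega> * resampled X T J (T 1 w) w) \<partial>M) = 1"
    and \<kappa>: "0 < \<kappa>" "\<And>i. i \<in> {1..d} \<Longrightarrow> \<kappa> \<le> cycle_moment i"
  shows "ruin_probability M (resampled X T J) u \<le> exp (- \<omega> * u) / \<kappa>"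
proof -
  have below: "ruin_probability M (resampled X T J) u \<le> exp (- \<omega> * v) / \<kappa>" if v: "v < u" for v
  proof -
    let ?E = "\<lambda>N. {w \<in> space M. \<not> clear (1 / 2 ^ N) v N w w}"
    have E: "?E N \<in> sets M" for N
      using diagonal_events(2)[of "1 / 2 ^ N" v N] by measurable
    have bound: "measure M (?E N) \<le> exp (- \<omega> * v) / \<kappa>" for N
    proof -
      have "ennreal (\<kappa> * exp (\<omega> * v)) * emeasure M (?E N) \<le> 1"
        by (rule order_trans[OF _ crossing_probability_bound[of "1 / 2 ^ N" \<kappa> v N,
                OF _ _ _ \<kappa>(2) mean_cycle_moment_eq_1[OF root]]])
           (use \<omega> \<kappa>(1) in auto)
      then have "\<kappa> * exp (\<omega> * v) * measure M (?E N) \<le> 1"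
        using \<kappa>(1) by (simp add: emeasure_eq_measure ennreal_mult'[symmetric])
      then show ?thesis using \<kappa>(1) by (simp add: field_simps exp_minus)
    qed
    have "incseq ?E" using clear_refine by (intro incseq_SucI) blast
    then have "(\<lambda>N. measure M (?E N)) \<longlonglongrightarrow> measure M (\<Union>N. ?E N)"
      using E by (intro finite_Lim_measure_incseq) auto
    then have "measure M (\<Union>N. ?E N) \<le> exp (- \<omega> * v) / \<kappa>"
      using bound by (intro LIMSEQ_le_const2[where X="\<lambda>N. measure M (?E N)"]) auto
    moreover have "ruin_probability M (resampled X T J) u \<le> measure M (\<Union>N. ?E N)"
      unfolding ruin_probability_def
    proof (rule finite_measure_mono)
      show "{w \<in> space M. \<exists>t\<ge>0. u \<le> resampled X T J t w} \<subseteq> (\<Union>N. ?E N)"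
      proof
        fix w assume "w \<in> {w \<in> space M. \<exists>t\<ge>0. u \<le> resampled X T J t w}"
        then obtain t where "w \<in> space M" "0 \<le> t" "u \<le> resampled X T J t w" by blast
        moreover from this have "v < resampled X T J t w" using v by linarith
        ultimately show "w \<in> (\<Union>N. ?E N)" using exceedance_imp_crossing by blast
      qed
      show "(\<Union>N. ?E N) \<in> sets M" using E by blast
    qed
    ultimately show ?thesis by simp
  qed
  have "((\<lambda>v. exp (- \<omega> * v) / \<kappa>) \<longlongrightarrow> exp (- \<omega> * u) / \<kappa>) (at_left u)"
    using \<kappa>(1) by (intro tendsto_intros) auto
  moreover have "eventually (\<lambda>v. ruin_probability M (resampled X T J) u \<le> exp (- \<omega> * v) / \<kappa>) (at_left u)"
    unfolding eventually_at_left_field using below by (intro exI[of _ "u - 1"]) simp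
  ultimately show ?thesis by (rule tendsto_lowerbound) simp
qed

end

section \<open>The bound on the ruin probability\<close>

theorem theorem2:
  fixes M :: "'w measure"
    and d :: nat
    and q \<omega> u :: real
    and p r s lam :: "nat \<Rightarrow> real"
    and nu :: "nat \<Rightarrow> real measure"
    and X :: "nat \<Rightarrow> real \<Rightarrow> 'w \<Rightarrow> real"
    and T :: "nat \<Rightarrow> 'w \<Rightarrow> real"
    and J :: "nat \<Rightarrow> 'w \<Rightarrow> nat"
  defines "phi \<equiv> \<lambda>i. laplace_exponent M (X i)"
    and "\<gamma> \<equiv> \<lambda>i. gamma_coeff q (r i) (s i) (lam i) (claim_transform (nu i) (- \<omega>))
                  (laplace_exponent M (X i) (- \<omega>)) \<omega>"
  assumes model: "resampled_risk_model M d q p r s lam nu X T J"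
    and negative_drift: "(\<Sum>i=1..d. p i * deriv (phi i) 0) > 0"
    and light_tails: "\<forall>i\<in>{1..d}. \<exists>\<epsilon>>0. \<forall>\<alpha>. \<bar>\<alpha>\<bar> < \<epsilon> \<longrightarrow> laplace_finite M (X i) \<alpha>"
    and omega_pos: "\<omega> > 0"
    and omega_root: "(\<integral>w. exp (\<omega> * resampled X T J (T 1 w) w) \<partial>M) = 1"
    and omega_finite: "\<forall>i\<in>{1..d}. laplace_finite M (X i) (- \<omega>) \<and> phi i (- \<omega>) < q"
    and u_nonneg: "u \<ge> 0"
  shows "ruin_probability M (resampled X T J) u
       \<le> Max ((\<lambda>i. (q - phi i (- \<omega>)) / q * max (\<gamma> i) 1) ` {1..d}) * exp (- \<omega> * u)"
proof -
  define c where "c = (\<lambda>i. (q - phi i (- \<omega>)) / q * max (\<gamma> i) 1)"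
  define \<Omega> where "\<Omega> = Max (c ` {1..d})"
  interpret prob_space M using model by (simp add: resampled_risk_model_def)
  interpret resampled_levy M d q \<omega> p X T J
  proof unfold_locales
    show "levy_process M (X i)" if "i \<in> {1..d}" for i
      using model that unfolding resampled_risk_model_def perturbed_risk_process_def by blast
    show "laplace_finite M (X i) (- \<omega>)" "laplace_exponent M (X i) (- \<omega>) < q" if "i \<in> {1..d}" for i
      using omega_finite that by (auto simp: phi_def)
    show "J n w \<in> {1..d}" if "w \<in> space M" for n w
      using model that unfolding resampled_risk_model_def by blast
    show "measure M {w \<in> space M. J n w = i} = p i" if "i \<in> {1..d}" for n i
      using model that unfolding resampled_risk_model_def by blast
  qed (use model in \<open>unfold resampled_risk_model_def, blast+\<close>)
  have "{1..d} \<noteq> {}"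
  proof
    assume "{1..d} = {}"
    moreover have "(\<Sum>i=1..d. p i) = 1"
      using model unfolding resampled_risk_model_def by blast
    ultimately show False by simp
  qed
  have ratio: "0 < (q - phi i (- \<omega>)) / q" "(q - phi i (- \<omega>)) / q \<le> \<Omega>" if i: "i \<in> {1..d}" for i
  proof -
    show pos: "0 < (q - phi i (- \<omega>)) / q"
      using q_pos tilt_below_rate[OF i] by (simp add: phi_def)
    have "(q - phi i (- \<omega>)) / q * 1 \<le> c i"
      unfolding c_def using pos by (intro mult_left_mono) auto
    also have "c i \<le> \<Omega>" unfolding \<Omega>_def using i by (intro Max_ge) auto
    finally show "(q - phi i (- \<omega>)) / q \<le> \<Omega>" by simp
  qed
  obtain i where "i \<in> {1..d}" using \<open>{1..d} \<noteq> {}\<close> by blast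
  then have \<Omega>: "0 < \<Omega>" using ratio[of i] by linarith
  have "1 / \<Omega> \<le> cycle_moment i" if i: "i \<in> {1..d}" for i
  proof -
    have "1 / \<Omega> \<le> 1 / ((q - phi i (- \<omega>)) / q)"
      using ratio[OF i] \<Omega> by (intro divide_left_mono mult_pos_pos) auto
    then show ?thesis by (simp add: cycle_moment_def tilt_def phi_def)
  qed
  then have "ruin_probability M (resampled X T J) u \<le> exp (- \<omega> * u) / (1 / \<Omega>)"
    using \<Omega> by (intro ruin_probability_bound omega_pos omega_root) auto
  then show ?thesis by (simp add: \<Omega>_def c_def mult.commute)
qed

end
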